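(* Let $A=(\mathcal H_A,\Theta_A)$ be a finite-dimensional system and let $\mathcal E$ be a quantum channel on $A$ whose Choi state is strictly positive, $\widetilde{\mathrm C}_{\mathcal E}>0$. Then $$\Delta^{\mathtt{TRS}}_m(\mathcal E)=\Delta^{\mathtt{Unital}}_m(\mathcal E)+\Delta^{\mathtt{TRS}}_m\Big(\operatorname*{arg\,min}_{\mathcal E'\in\mathtt{Unital}(A)}S(\widetilde{\mathrm C}_{\mathcal E'}\,\|\,\widetilde{\mathrm C}_{\mathcal E})\Big).$$ If moreover $\dim\mathcal H_A=2$, then $$\Delta^{\mathtt{TRS}}_e(\mathcal E)=\Delta^{\mathtt{Unital}}_e(\mathcal E)+\Delta^{\mathtt{TRS}}_e\Big(\operatorname*{arg\,min}_{\mathcal E'\in\mathtt{Unital}(A)}S(\widetilde{\mathrm C}_{\mathcal E}\,\|\,\widetilde{\mathrm C}_{\mathcal E'})\Big).$$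
   Context: A system $A=(\mathcal H_A,\Theta_A)$ is a finite-dimensional complex Hilbert space with a fixed orthonormal computational basis $\{|i\rangle\}$, together with an antiunitary operator $\Theta_A$ on $\mathcal H_A$ (the motion-reversal operator) satisfying $\Theta_A^2=e^{i\phi}\mathbb I$ for some phase $\phi$. The adjoint of an antilinear operator is defined by $\langle\psi|\Theta^\dagger\phi\rangle=\langle\phi|\Theta\psi\rangle$. Write $\mathrm{Ad}_O(\rho)=O\rho O^\dagger$. A channel on $A$ is a CPTP map $\mathcal E:\mathcal B(\mathcal H_A)\to\mathcal B(\mathcal H_A)$; $\mathcal E^\dagger$ is its Hilbert–Schmidt adjoint. It is unital if $\mathcal E(\mathbb I)=\mathbb I$, and T-symmetric if $\mathcal E=\mathcal E_\Theta$, where $\mathcal E_\Theta:=\mathrm{Ad}_{\Theta_A^\dagger}\circ\mathcal E^\dagger\circ\mathrm{Ad}_{\Theta_A}$. $\mathtt{Unital}(A)$ and $\mathtt{TRS}(A)$ denote the sets of unital and T-symmetric channels on $A$. The Choi state of $\mathcal E$ is $\widetilde{\mathrm C}_{\mathcal E}=\frac1d\sum_{i,j=1}^d\mathcal E(|i\rangle\langle j|)\otimes|i\rangle\langle j|$, $d=\dim\mathcal H_A$. The quantum relative entropy is $S(\rho\|\sigma)=\mathrm{Tr}[\rho\log\rho]-\mathrm{Tr}[\rho\log\sigma]$ (equal to $+\infty$ if the support of $\rho$ is not contained in that of $\sigma$). For $\mathtt F\in\{\mathtt{TRS},\mathtt{Unital}\}$ define $\Delta_m^{\mathtt F}(\mathcal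 E):=\min_{\mathcal E'\in\mathtt F(A)}S(\widetilde{\mathrm C}_{\mathcal E'}\|\widetilde{\mathrm C}_{\mathcal E})$ and $\Delta_e^{\mathtt F}(\mathcal E):=\min_{\mathcal E'\in\mathtt F(A)}S(\widetilde{\mathrm C}_{\mathcal E}\|\widetilde{\mathrm C}_{\mathcal E'})$. In the claim, $\arg\min$ denotes the (unique) minimizing unital channel. *)

theory Defs
  imports "HOL-Analysis.Analysis" "HOL-Library.Complex_Order"
begin

text \<open>
  The Hilbert space of a system is \<open>complex^'n\<close> with computational basis \<open>axis i 1\<close>;
  \<open>complex^'n^'n\<close> plays the role of the bounded operators on it. Positivity of operators is
  expressed with the order on complex numbers from \<^theory>\<open>HOL-Library.Complex_Order\<close>, for which
  \<open>0 \<le> z\<close> means that \<open>z\<close> is real and nonnegative.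
\<close>

definition cinner :: "complex^'n \<Rightarrow> complex^'n \<Rightarrow> complex" where
  "cinner x y = (\<Sum>i\<in>UNIV. cnj (x $ i) * y $ i)"

definition cscale :: "complex \<Rightarrow> complex^'m^'n \<Rightarrow> complex^'m^'n" where
  "cscale c A = (\<chi> i j. c * A $ i $ j)"

definition mdagger :: "complex^'m^'n \<Rightarrow> complex^'n^'m" where
  "mdagger A = (\<chi> i j. cnj (A $ j $ i))"

definition ketbra :: "complex^'n \<Rightarrow> complex^'m \<Rightarrow> complex^'m^'n" where
  "ketbra x y = (\<chi> i j. x $ i * cnj (y $ j))"

definition tensor :: "complex^'a^'a \<Rightarrow> complex^'b^'b \<Rightarrow> complex^('a \<times> 'b)^('a \<times> 'b)" where
  "tensor A B = (\<chi> p q. A $ fst p $ fst q * B $ snd p $ snd q)"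

definition posdef :: "complex^'n^'n \<Rightarrow> bool" where
  "posdef A \<longleftrightarrow> (\<forall>v. v \<noteq> 0 \<longrightarrow> 0 < cinner v (A *v v))"

definition unitary_matrix :: "complex^'n^'n \<Rightarrow> bool" where
  "unitary_matrix U \<longleftrightarrow> mdagger U ** U = mat 1 \<and> U ** mdagger U = mat 1"

definition real_diag :: "('n \<Rightarrow> real) \<Rightarrow> complex^'n^'n" where
  "real_diag d = (\<chi> i j. if i = j then complex_of_real (d i) else 0)"

text \<open>
  Functional calculus of Hermitian matrices: the value does not depend on the diagonalization
  \<open>A = U diag(d) U\<^sup>\<dagger>\<close>.
\<close>

definition herm_fun :: "(real \<Rightarrow> real) \<Rightarrow> complex^'n^'n \<Rightarrow> complex^'n^'n" where
  "herm_fun f A = (THE M. \<exists>U d. unitary_matrix U \<and> A = U ** real_diag d ** mdagger U \<and>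
     M = U ** real_diag (f \<circ> d) ** mdagger U)"

text \<open>
  The logarithm is taken on the support and extended by zero on the kernel, which implements
  the convention \<open>0 log 0 = 0\<close>.
\<close>

definition mlog :: "complex^'n^'n \<Rightarrow> complex^'n^'n" where
  "mlog = herm_fun (\<lambda>x. if 0 < x then ln x else 0)"

definition supp :: "complex^'n^'n \<Rightarrow> (complex^'n) set" where
  "supp A = {v. \<forall>w. A *v w = 0 \<longrightarrow> cinner w v = 0}"

definition rel_entropy :: "complex^'n^'n \<Rightarrow> complex^'n^'n \<Rightarrow> ereal" where
  "rel_entropy \<rho> \<sigma> =
     (if supp \<rho> \<subseteq> supp \<sigma>
      then ereal (Re (trace (\<rho> ** mlog \<rho>) - trace (\<rho> ** mlog \<sigma>)))
      else \<infinity>)"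

definition antilinear :: "(complex^'n \<Rightarrow> complex^'n) \<Rightarrow> bool" where
  "antilinear \<Theta> \<longleftrightarrow> (\<forall>x y. \<Theta> (x + y) = \<Theta> x + \<Theta> y) \<and> (\<forall>c x. \<Theta> (c *s x) = cnj c *s \<Theta> x)"

definition antiunitary :: "(complex^'n \<Rightarrow> complex^'n) \<Rightarrow> bool" where
  "antiunitary \<Theta> \<longleftrightarrow> antilinear \<Theta> \<and> surj \<Theta> \<and> (\<forall>x y. cinner (\<Theta> x) (\<Theta> y) = cnj (cinner x y))"

definition motion_reversal :: "(complex^'n \<Rightarrow> complex^'n) \<Rightarrow> bool" where
  "motion_reversal \<Theta> \<longleftrightarrow> antiunitary \<Theta> \<and> (\<exists>\<phi>::real. \<forall>v. \<Theta> (\<Theta> v) = cis \<phi> *s v)"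

definition anti_adjoint :: "(complex^'n \<Rightarrow> complex^'n) \<Rightarrow> complex^'n \<Rightarrow> complex^'n" where
  "anti_adjoint \<Theta> = (THE T. \<forall>\<psi> \<phi>. cinner \<psi> (T \<phi>) = cinner \<phi> (\<Theta> \<psi>))"

text \<open>
  For antilinear \<open>O\<close> the composition \<open>O \<circ> \<rho> \<circ> O\<^sup>\<dagger>\<close> is again a linear operator, hence
  given by its matrix in the computational basis.
\<close>

definition Ad :: "(complex^'n \<Rightarrow> complex^'n) \<Rightarrow> complex^'n^'n \<Rightarrow> complex^'n^'n" where
  "Ad T \<rho> = matrix (\<lambda>v. T (\<rho> *v anti_adjoint T v))"

type_synonym 'n superop = "complex^'n^'n \<Rightarrow> complex^'n^'n"

definition linear_superop :: "'n::finite superop \<Rightarrow> bool" where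
  "linear_superop \<E> \<longleftrightarrow> (\<forall>X Y. \<E> (X + Y) = \<E> X + \<E> Y) \<and> (\<forall>c X. \<E> (cscale c X) = cscale c (\<E> X))"

text \<open>
  A \<open>k\<close> by \<open>k\<close> block matrix with blocks \<open>X i j\<close>, \<open>i, j < k\<close>, is an operator on
  the tensor product of a \<open>k\<close>-dimensional ancilla with the system. Applying \<open>\<E>\<close> to every
  block is the action of \<open>id \<otimes> \<E>\<close>, so that complete positivity ranges over ancillas of all
  finite dimensions.
\<close>

definition block_psd :: "nat \<Rightarrow> (nat \<Rightarrow> nat \<Rightarrow> complex^'n^'n) \<Rightarrow> bool" where
  "block_psd k X \<longleftrightarrow>
     (\<forall>v :: nat \<Rightarrow> complex^'n. 0 \<le> (\<Sum>i<k. \<Sum>j<k. cinner (v i) (X i j *v v j)))"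

definition completely_positive :: "'n::finite superop \<Rightarrow> bool" where
  "completely_positive \<E> \<longleftrightarrow> (\<forall>k X. block_psd k X \<longrightarrow> block_psd k (\<lambda>i j. \<E> (X i j)))"

definition channel :: "'n::finite superop \<Rightarrow> bool" where
  "channel \<E> \<longleftrightarrow> linear_superop \<E> \<and> completely_positive \<E> \<and> (\<forall>X. trace (\<E> X) = trace X)"

definition hs_adjoint :: "'n::finite superop \<Rightarrow> 'n superop" where
  "hs_adjoint \<E> =
     (THE F. \<forall>X Y. trace (mdagger (F X) ** Y) = trace (mdagger X ** \<E> Y))"

definition motion_reversed :: "(complex^'n \<Rightarrow> complex^'n) \<Rightarrow> 'n::finite superop \<Rightarrow> 'n superop" where
  "motion_reversed \<Theta> \<E> = Ad (anti_adjoint \<Theta>) \<circ> hs_adjoint \<E> \<circ> Ad \<Theta>"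

definition Unital :: "'n::finite superop set" where
  "Unital = {\<E>. channel \<E> \<and> \<E> (mat 1) = mat 1}"

definition TRS :: "(complex^'n \<Rightarrow> complex^'n) \<Rightarrow> 'n::finite superop set" where
  "TRS \<Theta> = {\<E>. channel \<E> \<and> \<E> = motion_reversed \<Theta> \<E>}"

definition choi :: "'n::finite superop \<Rightarrow> complex^('n \<times> 'n)^('n \<times> 'n)" where
  "choi \<E> = cscale (1 / of_nat CARD('n))
     (\<Sum>i\<in>UNIV. \<Sum>j\<in>UNIV.
        tensor (\<E> (ketbra (axis i 1) (axis j 1))) (ketbra (axis i 1) (axis j 1)))"

text \<open>
  \<open>\<Delta>m\<close> and \<open>argmin_m\<close> minimize over the first argument of the relative entropy,
  \<open>\<Delta>e\<close> and \<open>argmin_e\<close> over the second. \<open>LEAST\<close> is the attained minimum.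
\<close>

definition \<Delta>m :: "'n::finite superop set \<Rightarrow> 'n superop \<Rightarrow> ereal" where
  "\<Delta>m F \<E> = (LEAST s. s \<in> (\<lambda>\<E>'. rel_entropy (choi \<E>') (choi \<E>)) ` F)"

definition \<Delta>e :: "'n::finite superop set \<Rightarrow> 'n superop \<Rightarrow> ereal" where
  "\<Delta>e F \<E> = (LEAST s. s \<in> (\<lambda>\<E>'. rel_entropy (choi \<E>) (choi \<E>')) ` F)"

definition is_argmin_m :: "'n::finite superop set \<Rightarrow> 'n superop \<Rightarrow> 'n superop \<Rightarrow> bool" where
  "is_argmin_m F \<E> = is_arg_min (\<lambda>\<E>'. rel_entropy (choi \<E>') (choi \<E>)) (\<lambda>\<E>'. \<E>' \<in> F)"

definition is_argmin_e :: "'n::finite superop set \<Rightarrow> 'n superop \<Rightarrow> 'n superop \<Rightarrow> bool" where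
  "is_argmin_e F \<E> = is_arg_min (\<lambda>\<E>'. rel_entropy (choi \<E>) (choi \<E>')) (\<lambda>\<E>'. \<E>' \<in> F)"

definition argmin_m :: "'n::finite superop set \<Rightarrow> 'n superop \<Rightarrow> 'n superop" where
  "argmin_m F \<E> = (THE \<E>'. is_argmin_m F \<E> \<E>')"

definition argmin_e :: "'n::finite superop set \<Rightarrow> 'n superop \<Rightarrow> 'n superop" where
  "argmin_e F \<E> = (THE \<E>'. is_argmin_e F \<E> \<E>')"

end

theory Submission
  imports Defs
begin

text \<open>
  Everything is a Pythagorean identity for the relative entropy of Choi matrices, because T-symmetric
  channels are unital.

  The unital Choi matrices are the positive semidefinite points of an affine space. A minimizer
  \<open>\<sigma>\<close> of \<open>S(\<sqdot>\<parallel>\<rho>)\<close> over them is positive definite, hence stationary, so that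
  \<open>S(\<tau>\<parallel>\<rho>) = S(\<tau>\<parallel>\<sigma>) + S(\<sigma>\<parallel>\<rho>)\<close> for all unital \<open>\<tau>\<close>; minimizing over T-symmetric \<open>\<tau>\<close> gives the
  first equation.

  For qubits, the unital Choi matrices are the fixed points of the spin flip, a self-adjoint involution
  that commutes with the functional calculus. So the average \<open>\<sigma>\<close> of \<open>\<rho>\<close> and its flip satisfies
  \<open>S(\<rho>\<parallel>\<tau>) = S(\<rho>\<parallel>\<sigma>) + S(\<sigma>\<parallel>\<tau>)\<close> for all unital \<open>\<tau>\<close>, as the logarithms of \<open>\<sigma>\<close> and \<open>\<tau>\<close> are fixed
  as well. Motion reversal of channels is unitary conjugation of Choi matrices, also
  such a symmetry, which yields the minimizer over the T-symmetric channels.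
\<close>

text \<open>The two arguments behave differently. For the first, \<open>divergence J \<rho>\<close>
  and \<open>divergence J \<sigma>\<close> differ by a functional linear in \<open>J\<close>, so
  stationarity at \<sigma> makes it constant on the affine set. This works in every dimension; the
  work lies in showing that the minimum is attained, and at a positive definite matrix. For the
  second, the identity asks that \<rho> - \<sigma> be orthogonal to log \<sigma> - log \<tau> for
  every admissible \<tau>, and a linear constraint is in general not inherited by the logarithm.
  Being fixed by a spectrum-preserving symmetry is inherited, and for qubits the unital constraint
  has this form.

  T-symmetric channels are unital because trace preservation of a channel is unitality of its
  adjoint, and conjugation by \<Theta> keeps the identity.

  Since \<open>mlog\<close> vanishes on kernels, the trace formula is finite even where the relative
  entropy is not; singular second arguments are therefore treated separately, with value infinity.
  \<open>LEAST\<close> and \<open>THE\<close> in the definitions force existence of all minimizers,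
  and uniqueness of the unital ones, to be proved along with the identities.\<close>

lemma complex_of_real_nonneg_iff: "0 \<le> complex_of_real x \<longleftrightarrow> 0 \<le> x"
  by (simp add: less_eq_complex_def)

lemma matrix_mult_nth: "(A ** B) $ i $ j = (\<Sum>k\<in>UNIV. A $ i $ k * B $ k $ j)"
  by (simp add: matrix_matrix_mult_def)

lemma matrix_vector_mult_nth: "(A *v x) $ i = (\<Sum>k\<in>UNIV. A $ i $ k * x $ k)"
  by (simp add: matrix_vector_mult_def)

lemma matrix_vector_mult_axis [simp]:
  fixes A :: "complex^'n^'m"
  shows "(A *v axis j 1) $ i = A $ i $ j"
  by (simp add: matrix_vector_mult_nth axis_def if_distrib[of "(*) _"] cong: if_cong)

lemma matrix_eqI: "(\<And>i j. A $ i $ j = B $ i $ j) \<Longrightarrow> A = B"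
  by (simp add: vec_eq_iff)

lemma mat_nth: "mat c $ i $ j = (if i = j then c else 0)"
  by (simp add: mat_def)

lemma mdagger_nth [simp]: "mdagger A $ i $ j = cnj (A $ j $ i)"
  by (simp add: mdagger_def)

lemma real_diag_nth: "real_diag d $ i $ j = (if i = j then complex_of_real (d i) else 0)"
  by (simp add: real_diag_def)

lemma ketbra_nth [simp]: "ketbra x y $ i $ j = x $ i * cnj (y $ j)"
  by (simp add: ketbra_def)

section \<open>Adjoints, the inner product and the trace\<close>

lemma mdagger_mdagger [simp]: "mdagger (mdagger A) = A"
  by (simp add: vec_eq_iff)

lemma mdagger_mult: "mdagger (A ** B) = mdagger B ** mdagger A"
  by (simp add: vec_eq_iff matrix_mult_nth mult.commute)

lemma mdagger_add: "mdagger (A + B) = mdagger A + mdagger B"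
  by (simp add: vec_eq_iff)

lemma mdagger_diff: "mdagger (A - B) = mdagger A - mdagger B"
  by (simp add: vec_eq_iff)

lemma mdagger_scaleR: "mdagger (r *\<^sub>R A) = r *\<^sub>R mdagger A"
  by (simp add: vec_eq_iff)

lemma mdagger_real_diag [simp]: "mdagger (real_diag d) = real_diag d"
  by (simp add: vec_eq_iff real_diag_nth)

lemma mdagger_mat_1 [simp]: "mdagger (mat 1) = mat 1"
  by (simp add: vec_eq_iff mat_nth)

lemma cinner_add_left: "cinner (x + y) z = cinner x z + cinner y z"
  by (simp add: cinner_def algebra_simps sum.distrib)

lemma cinner_add_right: "cinner x (y + z) = cinner x y + cinner x z"
  by (simp add: cinner_def algebra_simps sum.distrib)

lemma cinner_diff_left: "cinner (x - y) z = cinner x z - cinner y z"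
  by (simp add: cinner_def algebra_simps sum_subtractf)

lemma cinner_diff_right: "cinner x (y - z) = cinner x y - cinner x z"
  by (simp add: cinner_def algebra_simps sum_subtractf)

lemma cinner_scaleR_left: "cinner (r *\<^sub>R x) y = of_real r * cinner x y"
  unfolding cinner_def vector_scaleR_component
  by (simp add: scaleR_conv_of_real sum_distrib_left mult_ac)

lemma cinner_scaleR_right: "cinner x (r *\<^sub>R y) = of_real r * cinner x y"
  unfolding cinner_def vector_scaleR_component
  by (simp add: scaleR_conv_of_real sum_distrib_left mult_ac)

lemma cinner_zero_left [simp]: "cinner 0 x = 0"
  by (simp add: cinner_def)

lemma cinner_zero_right [simp]: "cinner x 0 = 0"
  by (simp add: cinner_def)

lemma cnj_cinner: "cnj (cinner x y) = cinner y x"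
  by (simp add: cinner_def mult.commute)

lemma cinner_self: "cinner x x = complex_of_real ((norm x)\<^sup>2)"
  by (simp add: cinner_def norm_vec_def L2_set_def sum_nonneg complex_norm_square[symmetric]
      mult.commute)

lemma cinner_axis_left [simp]: "cinner (axis i 1) x = x $ i"
  by (simp add: cinner_def axis_def if_distrib[of cnj] if_distrib[of "\<lambda>z. z * _"] cong: if_cong)

lemma cinner_mult_right: "cinner x (A *v y) = cinner (mdagger A *v x) y"
  unfolding cinner_def matrix_vector_mult_nth
  by (simp add: sum_distrib_left sum_distrib_right mult_ac) (rule sum.swap)

lemma cinner_mult_left: "cinner (A *v x) y = cinner x (mdagger A *v y)"
  by (simp add: cinner_mult_right)

lemma matrix_vector_mult_scaleR:
  fixes A :: "complex^'n^'m"
  shows "A *v (r *\<^sub>R x) = r *\<^sub>R (A *v x)" "(r *\<^sub>R A) *v x = r *\<^sub>R (A *v x)"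
  by (simp_all add: vec_eq_iff matrix_vector_mult_nth scaleR_sum_right)

lemma matrix_mult_scaleR:
  fixes A :: "complex^'n^'m"
  shows "A ** (r *\<^sub>R B) = r *\<^sub>R (A ** B)" "(r *\<^sub>R A) ** B = r *\<^sub>R (A ** B)"
  by (simp_all add: vec_eq_iff matrix_mult_nth scaleR_sum_right)

lemma matrix_mult_add_left:
  fixes A B :: "complex^'n^'m"
  shows "(A + B) ** C = A ** C + B ** C"
  by (simp add: vec_eq_iff matrix_mult_nth algebra_simps sum.distrib)

lemma matrix_mult_diff:
  fixes A B :: "complex^'n^'m"
  shows "(A - B) ** C = A ** C - B ** C" "D ** (A - B) = D ** A - D ** B"
  by (simp_all add: vec_eq_iff matrix_mult_nth algebra_simps sum_subtractf)

lemma trace_scaleR: "trace (r *\<^sub>R A) = r *\<^sub>R trace (A :: complex^'n^'n)"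
  by (simp add: trace_def scaleR_sum_right)

lemma trace_mdagger: "trace (mdagger A) = cnj (trace A)"
  by (simp add: trace_def)

text \<open>The norm of nested vectors is the Hilbert-Schmidt norm, so distances between matrices
  can be computed in any pair of orthonormal bases.\<close>

lemma norm_matrix_square: "complex_of_real ((norm A)\<^sup>2) = trace (mdagger A ** A)"
  for A :: "complex^'n^'m"
proof -
  have "complex_of_real ((norm A)\<^sup>2) = (\<Sum>i\<in>UNIV. \<Sum>j\<in>UNIV. cnj (A $ i $ j) * A $ i $ j)"
    by (simp add: norm_vec_def L2_set_def sum_nonneg complex_norm_square[symmetric] mult.commute)
  also have "\<dots> = trace (mdagger A ** A)"
    unfolding trace_def matrix_mult_nth mdagger_nth by (rule sum.swap)
  finally show ?thesis .
qed

subsection \<open>Positive semidefinite matrices and the spectral theorem\<close>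

text \<open>The order on the complex numbers makes nonnegativity include reality, so Hermiticity is
  a consequence rather than a further clause.\<close>

definition psd :: "complex^'n^'n \<Rightarrow> bool" where
  "psd A \<longleftrightarrow> (\<forall>v. 0 \<le> cinner v (A *v v))"

lemma posdef_imp_psd: "posdef A \<Longrightarrow> psd A"
  unfolding psd_def posdef_def by (metis cinner_zero_left order.refl order.strict_implies_order)

lemma posdef_mat_1: "posdef (mat 1)"
  by (simp add: posdef_def cinner_self less_complex_def)

text \<open>The quadratic form of \<open>mdagger A - A\<close> vanishes. Polarization gives only an
  antisymmetry of the sesquilinear form; replacing y by \<i> y also gives symmetry, so the form is
  zero.\<close>

lemma hermitian_if_form_real:
  assumes "\<And>v. cinner v (A *v v) \<in> \<real>"
  shows "mdagger A = A"
proof -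
  have form: "cinner (mdagger A *v v) v = cinner (A *v v) v" for v
  proof -
    have "cinner (mdagger A *v v) v = cinner v (A *v v)"
      by (simp add: cinner_mult_right)
    also have "\<dots> = cnj (cinner v (A *v v))"
      using assms Reals_cnj_iff by metis
    also have "\<dots> = cinner (A *v v) v"
      by (rule cnj_cinner)
    finally show ?thesis .
  qed
  define B where "B = mdagger A - A"
  have B: "cinner v (B *v v) = 0" for v
  proof -
    have "cinner (B *v v) v = 0"
      by (simp add: B_def matrix_vector_mult_diff_rdistrib cinner_diff_left form)
    then show ?thesis by (metis cnj_cinner complex_cnj_zero)
  qed
  have pol: "cinner x (B *v y) + cinner y (B *v x) = 0" for x y
    using B[of "x + y"] B[of x] B[of y]
    by (simp add: matrix_vector_right_distrib cinner_add_left cinner_add_right add.commute)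
  have "cinner x (B *v y) = 0" for x y
  proof -
    have "\<i> * cinner x (B *v y) - \<i> * cinner y (B *v x) = 0"
      using pol[of x "\<i> *s y"]
      by (simp add: cinner_def matrix_vector_mult_nth sum_distrib_left sum_negf mult_ac)
    then have "cinner x (B *v y) = cinner y (B *v x)"
      by (simp flip: right_diff_distrib)
    with pol[of x y] show ?thesis by simp
  qed
  then have "B $ i $ j = 0" for i j
    using cinner_axis_left[of i "B *v axis j 1"] by (simp add: matrix_vector_mult_axis)
  then show ?thesis by (simp add: B_def vec_eq_iff)
qed

lemma psd_imp_hermitian: "psd A \<Longrightarrow> mdagger A = A"
  by (rule hermitian_if_form_real) (simp add: psd_def nonnegative_complex_is_real)

lemma posdef_imp_hermitian: "posdef A \<Longrightarrow> mdagger A = A"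
  by (rule psd_imp_hermitian[OF posdef_imp_psd])

lemma hermitian_form_real:
  assumes "mdagger A = A"
  shows "cinner v (A *v v) = of_real (Re (cinner v (A *v v)))"
proof -
  have "cnj (cinner v (A *v v)) = cinner v (A *v v)"
    by (simp add: cnj_cinner cinner_mult_left assms)
  then show ?thesis by (metis Reals_cnj_iff of_real_Re)
qed

lemma psd_iff_Re:
  assumes "mdagger A = A"
  shows "psd A \<longleftrightarrow> (\<forall>v. 0 \<le> Re (cinner v (A *v v)))"
  unfolding psd_def by (subst hermitian_form_real[OF assms]) (simp add: less_eq_complex_def)

lemma posdef_iff_Re:
  assumes "mdagger A = A"
  shows "posdef A \<longleftrightarrow> (\<forall>v. v \<noteq> 0 \<longrightarrow> 0 < Re (cinner v (A *v v)))"
  unfolding posdef_def by (subst hermitian_form_real[OF assms]) (simp add: less_complex_def)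

lemma continuous_on_matrix_vector_mult [continuous_intros]:
  fixes A :: "'a::topological_space \<Rightarrow> complex^'n^'m"
  assumes "continuous_on S A" "continuous_on S x"
  shows "continuous_on S (\<lambda>t. A t *v x t)"
  unfolding matrix_vector_mult_def by (intro continuous_intros assms)

lemma continuous_on_cinner [continuous_intros]:
  assumes "continuous_on S x" "continuous_on S y"
  shows "continuous_on S (\<lambda>t. cinner (x t) (y t))"
  unfolding cinner_def by (intro continuous_intros assms)

lemma continuous_on_matrix_mult [continuous_intros]:
  fixes A :: "'a::topological_space \<Rightarrow> complex^'n^'m"
  assumes "continuous_on S A" "continuous_on S B"
  shows "continuous_on S (\<lambda>t. A t ** B t)"
  unfolding matrix_matrix_mult_def by (intro continuous_intros assms)

lemma continuous_on_trace [continuous_intros]: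
  fixes A :: "'a::topological_space \<Rightarrow> complex^'n^'n"
  assumes "continuous_on S A"
  shows "continuous_on S (\<lambda>t. trace (A t))"
  unfolding trace_def by (intro continuous_intros assms)

text \<open>A maximizer \<open>v\<close> of the Rayleigh quotient on the complement, with value \<open>r\<close>, makes \<open>r - A\<close>
  positive semidefinite there and annihilates its form; perturbing \<open>v\<close> in the direction
  \<open>(r - A) v\<close> shows that \<open>v\<close> is an eigenvector.\<close>

lemma hermitian_eigenvector_on_orthogonal_complement:
  fixes A :: "complex^'n^'n" and u :: "'i \<Rightarrow> complex^'n"
  assumes herm: "mdagger A = A"
    and eig: "\<And>i. i \<in> I \<Longrightarrow> A *v u i = e i *\<^sub>R u i"
    and v0: "v0 \<noteq> 0" "\<And>i. i \<in> I \<Longrightarrow> cinner (u i) v0 = 0"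
  obtains v r where "norm v = 1" "\<And>i. i \<in> I \<Longrightarrow> cinner (u i) v = 0" "A *v v = r *\<^sub>R v"
proof -
  define M where "M = {v. \<forall>i\<in>I. cinner (u i) v = 0}"
  have M_scale: "r *\<^sub>R v \<in> M" if "v \<in> M" for v r
    using that by (simp add: M_def cinner_scaleR_right)
  have M_add: "v + w \<in> M" if "v \<in> M" "w \<in> M" for v w
    using that by (simp add: M_def cinner_add_right)
  have M_A: "A *v v \<in> M" if "v \<in> M" for v
    using that by (simp add: M_def cinner_mult_right herm eig cinner_scaleR_left)
  define q where "q v = Re (cinner v (A *v v))" for v
  have q_scale: "q (c *\<^sub>R w) = c\<^sup>2 * q w" for c w
    by (simp add: q_def matrix_vector_mult_scaleR cinner_scaleR_left cinner_scaleR_right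
        power2_eq_square)
  have "closed M"
    unfolding M_def Ball_def imp_conv_disj
    by (intro closed_Collect_all closed_Collect_disj closed_Collect_const closed_Collect_eq
        continuous_intros)
  then have "compact (M \<inter> sphere 0 1)"
    by (intro closed_Int_compact) auto
  moreover have "v0 /\<^sub>R norm v0 \<in> M \<inter> sphere 0 1"
    using v0 M_scale[of v0 "inverse (norm v0)"] by (simp add: M_def)
  moreover have "continuous_on (M \<inter> sphere 0 1) q"
    unfolding q_def by (intro continuous_intros)
  ultimately obtain v where v: "v \<in> M \<inter> sphere 0 1"
    and max: "\<And>w. w \<in> M \<inter> sphere 0 1 \<Longrightarrow> q w \<le> q v"
    using continuous_attains_sup[of "M \<inter> sphere 0 1" q] by blast
  define r where "r = q v"
  have nv: "norm v = 1" and vM: "v \<in> M" using v by auto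
  have q_le: "q w \<le> r * (norm w)\<^sup>2" if "w \<in> M" for w
  proof (cases "w = 0")
    case False
    have "q (w /\<^sub>R norm w) = q w / (norm w)\<^sup>2"
      unfolding q_scale by (simp add: power_inverse divide_inverse)
    moreover have "q (w /\<^sub>R norm w) \<le> r"
      unfolding r_def using False M_scale[OF that] by (intro max) simp
    ultimately show ?thesis using False by (simp add: divide_le_eq)
  qed (simp add: q_def)
  define z where "z = r *\<^sub>R v - A *v v"
  have zM: "z \<in> M"
    using M_add[OF M_scale[OF vM, of r] M_scale[OF M_A[OF vM], of "-1"]] by (simp add: z_def)
  have nz: "Re (cinner z z) = (norm z)\<^sup>2" by (simp add: cinner_self)
  have key: "0 \<le> 2 * t * (norm z)\<^sup>2 + t\<^sup>2 * (r * (norm z)\<^sup>2 - q z)" for t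
  proof -
    let ?B = "\<lambda>w. r *\<^sub>R w - A *v w"
    have form: "r * (norm w)\<^sup>2 - q w = Re (cinner w (?B w))" for w
      by (simp add: q_def cinner_diff_right cinner_scaleR_right cinner_self)
    have lin: "?B (v + t *\<^sub>R z) = ?B v + t *\<^sub>R ?B z"
      by (simp add: matrix_vector_right_distrib matrix_vector_mult_scaleR scaleR_add_right
          scaleR_diff_right scaleR_left_commute)
    have B0: "Re (cinner v (?B v)) = 0"
      using form[of v] nv by (simp add: r_def)
    have sym: "cinner v (?B z) = cinner (?B v) z"
      by (simp add: cinner_diff_left cinner_diff_right cinner_scaleR_left cinner_scaleR_right
          cinner_mult_right herm)
    have "0 \<le> r * (norm (v + t *\<^sub>R z))\<^sup>2 - q (v + t *\<^sub>R z)"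
      using q_le[OF M_add[OF vM M_scale[OF zM, of t]]] by simp
    also have "\<dots> = Re (cinner (v + t *\<^sub>R z) (?B v + t *\<^sub>R ?B z))"
      unfolding form lin ..
    also have "\<dots> = Re (cinner v (?B v)) + t * Re (cinner v (?B z)) + t * Re (cinner z (?B v))
        + t\<^sup>2 * Re (cinner z (?B z))"
      unfolding cinner_add_left cinner_add_right cinner_scaleR_left cinner_scaleR_right
      by (simp add: distrib_left power2_eq_square)
    also have "\<dots> = 2 * t * (norm z)\<^sup>2 + t\<^sup>2 * (r * (norm z)\<^sup>2 - q z)"
      using B0 nz by (simp only: sym form z_def[symmetric])
    finally show ?thesis .
  qed
  have "norm z = 0"
  proof (rule ccontr)
    assume "norm z \<noteq> 0"
    then have zp: "(norm z)\<^sup>2 > 0" by simp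
    define c where "c = r * (norm z)\<^sup>2 - q z"
    have c0: "0 \<le> c" using q_le[OF zM] by (simp add: c_def)
    define t where "t = - (norm z)\<^sup>2 / (c + 1)"
    have "t * c \<ge> - (norm z)\<^sup>2"
      using c0 zp by (simp add: t_def field_simps)
    moreover have "t < 0" using c0 zp by (simp add: t_def divide_neg_pos)
    ultimately have "t * (2 * (norm z)\<^sup>2 + t * c) < 0"
      using zp by (intro mult_neg_pos; linarith)
    moreover have "0 \<le> 2 * t * (norm z)\<^sup>2 + t\<^sup>2 * c" using key[of t] by (simp only: c_def)
    ultimately show False by (simp add: algebra_simps power2_eq_square)
  qed
  then have "A *v v = r *\<^sub>R v" by (simp add: z_def)
  with nv vM show ?thesis by (intro that[of v r]) (simp_all add: M_def)
qed

definition diagonalizes :: "complex^'n^'n \<Rightarrow> ('n \<Rightarrow> real) \<Rightarrow> complex^'n^'n \<Rightarrow> bool" where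
  "diagonalizes U d A \<longleftrightarrow> unitary_matrix U \<and> A = U ** real_diag d ** mdagger U"

lemma matrix_mult_real_diag_nth:
  "(A ** real_diag d) $ i $ j = A $ i $ j * of_real (d j)"
  by (simp add: matrix_mult_nth real_diag_nth if_distrib[of "(*) _"] cong: if_cong)

lemma real_diag_matrix_mult_nth:
  "(real_diag d ** A) $ i $ j = of_real (d i) * A $ i $ j"
  by (simp add: matrix_mult_nth real_diag_nth if_distrib[of "\<lambda>z. z * _"] cong: if_cong)

text \<open>A largest orthonormal family of eigenvectors must be a basis, since any vector
  orthogonal to it would yield another eigenvector. Indexing the family by coordinates of
  \<open>'n\<close> lets it be read as the columns of a square matrix.\<close>

theorem hermitian_diagonalizable:
  fixes A :: "complex^'n^'n"
  assumes herm: "mdagger A = A"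
  obtains U d where "diagonalizes U d A"
proof -
  define good where "good I u e \<longleftrightarrow>
      (\<forall>i\<in>I. \<forall>j\<in>I. cinner (u i) (u j) = (if i = j then 1 else 0)) \<and>
      (\<forall>i\<in>I. A *v u i = e i *\<^sub>R u i)" for I :: "'n set" and u e
  define P where "P I \<longleftrightarrow> (\<exists>u e. good I u e)" for I
  have "P {}" by (auto simp: P_def good_def)
  then obtain I where "P I" and maxI: "\<And>J. P J \<Longrightarrow> card J \<le> card I"
  proof -
    have "\<forall>J. P J \<longrightarrow> card J < Suc CARD('n)"
      by (simp add: card_mono less_Suc_eq_le)
    from ex_has_greatest_nat[OF \<open>P {}\<close> this] show ?thesis using that by blast
  qed
  then obtain u e where ue: "good I u e" by (auto simp: P_def)
  have "I = UNIV"
  proof (rule ccontr)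
    assume "I \<noteq> UNIV"
    then obtain k where k: "k \<notin> I" by blast
    define R :: "complex^'n^'n" where "R = (\<chi> i j. if i \<in> I then cnj (u i $ j) else 0)"
    have "row k R = 0" using k by (simp add: R_def row_def vec_eq_iff)
    then have "det R = 0" by (rule det_zero_row)
    then have "\<not> invertible R" by (simp add: invertible_det_nz)
    then obtain v0 where v0: "v0 \<noteq> 0" "R *v v0 = 0"
      unfolding invertible_left_inverse matrix_left_invertible_ker by blast
    have "cinner (u i) v0 = 0" if "i \<in> I" for i
    proof -
      have "cinner (u i) v0 = (R *v v0) $ i"
        using that by (simp add: R_def cinner_def matrix_vector_mult_nth)
      then show ?thesis by (simp add: v0)
    qed
    with ue v0(1) herm obtain v r where v: "norm v = 1" "\<And>i. i \<in> I \<Longrightarrow> cinner (u i) v = 0"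
        "A *v v = r *\<^sub>R v"
      by (elim hermitian_eigenvector_on_orthogonal_complement[of A I u e v0])
        (auto simp: good_def)
    have v': "cinner v (u i) = 0" if "i \<in> I" for i
      using v(2)[OF that] by (metis cnj_cinner complex_cnj_zero)
    have vv: "cinner v v = 1" by (simp add: cinner_self v)
    have "good (insert k I) (u(k := v)) (e(k := r))"
      using ue v(2,3) v' vv k by (simp add: good_def)
    then have "card (insert k I) \<le> card I" by (intro maxI) (auto simp: P_def)
    with k show False by simp
  qed
  define U :: "complex^'n^'n" where "U = (\<chi> i j. u j $ i)"
  have UU: "mdagger U ** U = mat 1"
    using ue \<open>I = UNIV\<close>
    by (simp add: vec_eq_iff matrix_mult_nth mat_nth U_def good_def flip: cinner_def)
  then have UU': "U ** mdagger U = mat 1" by (simp add: matrix_left_right_inverse)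
  have "A ** U = U ** real_diag e"
  proof -
    have "(A ** U) $ i $ j = (A *v u j) $ i" for i j
      by (simp add: U_def matrix_mult_nth matrix_vector_mult_nth)
    then show ?thesis
      using ue \<open>I = UNIV\<close>
      by (simp add: vec_eq_iff good_def matrix_mult_real_diag_nth)
        (simp add: U_def scaleR_conv_of_real mult.commute)
  qed
  then have "A = U ** real_diag e ** mdagger U"
    by (metis UU' matrix_mul_assoc matrix_mul_rid)
  with UU UU' have "diagonalizes U e A"
    by (simp add: diagonalizes_def unitary_matrix_def)
  then show ?thesis by (rule that)
qed

lemma unitary_matrixD:
  assumes "unitary_matrix U"
  shows "mdagger U ** U = mat 1" "U ** mdagger U = mat 1"
  using assms by (simp_all add: unitary_matrix_def)

lemma unitary_cancel [simp]:
  assumes "unitary_matrix U"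
  shows "mdagger U ** (U ** A) = A" "U ** (mdagger U ** A) = A"
    "A ** U ** mdagger U = A" "A ** mdagger U ** U = A"
proof -
  show "mdagger U ** (U ** A) = A" "U ** (mdagger U ** A) = A"
    by (simp_all add: assms unitary_matrixD matrix_mul_assoc)
  show "A ** U ** mdagger U = A" "A ** mdagger U ** U = A"
    by (simp_all add: assms unitary_matrixD flip: matrix_mul_assoc)
qed

lemma unitary_matrix_mdagger: "unitary_matrix U \<Longrightarrow> unitary_matrix (mdagger U)"
  by (simp add: unitary_matrix_def)

lemma unitary_matrix_mult:
  assumes "unitary_matrix U" "unitary_matrix V"
  shows "unitary_matrix (U ** V)"
  using assms by (simp add: unitary_matrix_def mdagger_mult matrix_mul_assoc)

lemma diagonalizesI:
  "unitary_matrix U \<Longrightarrow> A = U ** real_diag d ** mdagger U \<Longrightarrow> diagonalizes U d A"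
  by (simp add: diagonalizes_def)

lemma diagonalizes_hermitian: "diagonalizes U d A \<Longrightarrow> mdagger A = A"
  by (simp add: diagonalizes_def mdagger_mult matrix_mul_assoc)

lemma trace_diagonalizes:
  assumes "diagonalizes U d A"
  shows "trace A = complex_of_real (\<Sum>i\<in>UNIV. d i)"
proof -
  have "trace A = trace (mdagger U ** (U ** real_diag d))"
    using assms by (simp add: diagonalizes_def trace_mul_sym)
  also have "\<dots> = trace (real_diag d)"
    using assms by (simp add: diagonalizes_def)
  finally show ?thesis by (simp add: trace_def real_diag_nth)
qed

lemma cinner_diagonalizes:
  assumes "diagonalizes U d A"
  shows "cinner v (A *v v) = complex_of_real (\<Sum>i\<in>UNIV. d i * (cmod ((mdagger U *v v) $ i))\<^sup>2)"
proof -
  define w where "w = mdagger U *v v"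
  have "A *v v = U *v (real_diag d *v w)"
    using assms by (simp add: diagonalizes_def w_def matrix_vector_mul_assoc matrix_mul_assoc)
  then have "cinner v (A *v v) = cinner w (real_diag d *v w)"
    by (simp add: cinner_mult_right w_def)
  also have "\<dots> = (\<Sum>i\<in>UNIV. cnj (w $ i) * (of_real (d i) * w $ i))"
    by (simp add: cinner_def matrix_vector_mult_nth real_diag_nth if_distrib[of "\<lambda>z. z * _"]
        cong: if_cong)
  also have "\<dots> = complex_of_real (\<Sum>i\<in>UNIV. d i * (cmod (w $ i))\<^sup>2)"
    unfolding of_real_sum of_real_mult complex_norm_square by (simp add: mult_ac)
  finally show ?thesis by (simp add: w_def)
qed

lemma norm_unitary_mult:
  assumes "unitary_matrix U"
  shows "norm (U *v v) = norm v"
proof -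
  have "cinner (U *v v) (U *v v) = cinner v v"
    using assms by (simp add: cinner_mult_left matrix_vector_mul_assoc unitary_matrixD)
  then show ?thesis by (simp add: cinner_self flip: of_real_power)
qed

lemma diagonalizes_eigenvector_form:
  assumes "diagonalizes U d A"
  shows "cinner (U *v axis i 1) (A *v (U *v axis i 1)) = complex_of_real (d i)"
proof -
  have "mdagger U *v (U *v axis i 1) = axis i 1"
    using assms by (simp add: diagonalizes_def matrix_vector_mul_assoc unitary_matrixD)
  then show ?thesis
    by (simp add: cinner_diagonalizes[OF assms] axis_def if_distrib[of cmod]
        if_distrib[of "\<lambda>x. x\<^sup>2"] if_distrib[of "(*) _"] cong: if_cong)
qed

lemma psd_iff_eigenvalues:
  assumes "diagonalizes U d A"
  shows "psd A \<longleftrightarrow> (\<forall>i. 0 \<le> d i)"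
proof
  assume "psd A"
  then show "\<forall>i. 0 \<le> d i"
    unfolding psd_def using diagonalizes_eigenvector_form[OF assms]
    by (metis complex_of_real_nonneg_iff)
next
  assume "\<forall>i. 0 \<le> d i"
  then show "psd A"
    unfolding psd_def cinner_diagonalizes[OF assms] complex_of_real_nonneg_iff
    by (simp add: sum_nonneg)
qed

lemma form_bounds:
  assumes "diagonalizes U d A" and "\<And>i. l \<le> d i" and "\<And>i. d i \<le> u"
  shows "l * (norm v)\<^sup>2 \<le> Re (cinner v (A *v v))" "Re (cinner v (A *v v)) \<le> u * (norm v)\<^sup>2"
proof -
  have "unitary_matrix (mdagger U)"
    using assms(1) by (simp add: diagonalizes_def unitary_matrix_mdagger)
  then have n: "(norm v)\<^sup>2 = (\<Sum>i\<in>UNIV. (cmod ((mdagger U *v v) $ i))\<^sup>2)"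
    unfolding norm_unitary_mult[OF \<open>unitary_matrix (mdagger U)\<close>, of v, symmetric]
    by (simp add: norm_vec_def[of "mdagger U *v v"] L2_set_def sum_nonneg)
  show "l * (norm v)\<^sup>2 \<le> Re (cinner v (A *v v))" "Re (cinner v (A *v v)) \<le> u * (norm v)\<^sup>2"
    unfolding cinner_diagonalizes[OF assms(1)] n Re_complex_of_real sum_distrib_left
    using assms by (auto intro!: sum_mono mult_right_mono)
qed

lemma posdef_iff_eigenvalues:
  assumes "diagonalizes U d A"
  shows "posdef A \<longleftrightarrow> (\<forall>i. 0 < d i)"
proof
  assume A: "posdef A"
  have "0 < d i" for i
  proof -
    have "norm (U *v axis i 1) = 1"
      using assms by (simp add: diagonalizes_def norm_unitary_mult)
    then have "U *v axis i 1 \<noteq> 0" by force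
    then show ?thesis
      using A diagonalizes_eigenvector_form[OF assms, of i]
      by (simp add: posdef_def less_complex_def) (metis Re_complex_of_real)
  qed
  then show "\<forall>i. 0 < d i" by blast
next
  assume d: "\<forall>i. 0 < d i"
  define l where "l = Min (range d)"
  have l: "0 < l" "\<And>i. l \<le> d i" using d by (auto simp: l_def)
  have "0 < Re (cinner v (A *v v))" if "v \<noteq> 0" for v
    using form_bounds(1)[OF assms l(2), of "Max (range d)" v] l(1) that
    by (smt (verit, ccfv_threshold) Max_ge UNIV_I finite finite_imageI image_eqI mult_pos_pos
        zero_less_norm_iff zero_less_power)
  then show "posdef A"
    by (simp add: posdef_iff_Re[OF diagonalizes_hermitian[OF assms]])
qed

lemma psd_diagonalizable:
  assumes "psd A"
  obtains U d where "diagonalizes U d A" "\<And>i. 0 \<le> d i"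
  using hermitian_diagonalizable[OF psd_imp_hermitian[OF assms]] psd_iff_eigenvalues assms
  by metis

lemma posdef_diagonalizable:
  assumes "posdef A"
  obtains U d where "diagonalizes U d A" "\<And>i. 0 < d i"
  using hermitian_diagonalizable[OF posdef_imp_hermitian[OF assms]] posdef_iff_eigenvalues assms
  by metis

subsection \<open>Functional calculus\<close>

text \<open>The change of basis \<open>W\<close> intertwines the two diagonal matrices, so its
  entries vanish except between equal eigenvalues, and there it intertwines every function of them
  as well. This makes the description in \<open>herm_fun\<close> unique.\<close>

lemma diagonalizes_cong:
  fixes A :: "complex^'n^'n"
  assumes "diagonalizes U d A" "diagonalizes V e A"
  shows "U ** real_diag (f \<circ> d) ** mdagger U = V ** real_diag (f \<circ> e) ** mdagger V"
proof -
  have U: "unitary_matrix U" and V: "unitary_matrix V"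
    and eq: "U ** real_diag d ** mdagger U = V ** real_diag e ** mdagger V"
    using assms by (auto simp: diagonalizes_def)
  define W where "W = mdagger V ** U"
  have "mdagger V ** (U ** real_diag d ** mdagger U) ** U
      = mdagger V ** (V ** real_diag e ** mdagger V) ** U"
    by (simp add: eq)
  then have "W ** real_diag d = real_diag e ** W"
    using U V by (simp add: W_def flip: matrix_mul_assoc) (simp add: matrix_mul_assoc unitary_matrixD)
  then have "W $ i $ j * of_real (d j) = of_real (e i) * W $ i $ j" for i j
    by (metis matrix_mult_real_diag_nth real_diag_matrix_mult_nth)
  then have "W $ i $ j = 0 \<or> d j = e i" for i j
    by (metis mult.commute mult_cancel_left of_real_eq_iff)
  then have "W $ i $ j * of_real (f (d j)) = of_real (f (e i)) * W $ i $ j" for i j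
    by (metis mult.commute mult_zero_right)
  then have Wf: "W ** real_diag (f \<circ> d) = real_diag (f \<circ> e) ** W"
    by (simp add: vec_eq_iff matrix_mult_real_diag_nth real_diag_matrix_mult_nth)
  have "U ** real_diag (f \<circ> d) ** mdagger U = V ** (W ** real_diag (f \<circ> d)) ** mdagger U"
    using V by (simp add: W_def flip: matrix_mul_assoc)
  also have "\<dots> = V ** real_diag (f \<circ> e) ** mdagger V"
    unfolding Wf using U by (simp add: W_def matrix_mul_assoc)
  finally show ?thesis .
qed

lemma herm_fun_diagonalizes:
  assumes "diagonalizes U d A"
  shows "herm_fun f A = U ** real_diag (f \<circ> d) ** mdagger U"
  unfolding herm_fun_def diagonalizes_def[symmetric]
proof (rule the_equality)
  show "\<exists>V e. unitary_matrix V \<and> A = V ** real_diag e ** mdagger V \<and>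
      U ** real_diag (f \<circ> d) ** mdagger U = V ** real_diag (f \<circ> e) ** mdagger V"
    using assms by (auto simp: diagonalizes_def)
next
  fix M
  assume "\<exists>V e. unitary_matrix V \<and> A = V ** real_diag e ** mdagger V \<and>
      M = V ** real_diag (f \<circ> e) ** mdagger V"
  then show "M = U ** real_diag (f \<circ> d) ** mdagger U"
    using diagonalizes_cong[OF _ assms] by (auto simp: diagonalizes_def)
qed

definition ln0 :: "real \<Rightarrow> real" where
  "ln0 x = (if 0 < x then ln x else 0)"

lemma mlog_diagonalizes:
  "diagonalizes U d A \<Longrightarrow> diagonalizes U (ln0 \<circ> d) (mlog A)"
  unfolding mlog_def ln0_def[abs_def, symmetric]
  by (rule diagonalizesI, simp add: diagonalizes_def, rule herm_fun_diagonalizes)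

text \<open>Squared transition amplitudes between two eigenbases. For unitary \<open>U\<close> and
  \<open>V\<close> they form a doubly stochastic array, which reduces trace inequalities for
  noncommuting matrices to scalar ones.\<close>

definition overlap :: "complex^'n^'n \<Rightarrow> complex^'n^'n \<Rightarrow> 'n \<Rightarrow> 'n \<Rightarrow> real" where
  "overlap U V i j = (cmod ((mdagger U ** V) $ i $ j))\<^sup>2"

lemma overlap_nonneg [simp]: "0 \<le> overlap U V i j"
  by (simp add: overlap_def)

lemma unitary_row_col_sums:
  assumes "unitary_matrix W"
  shows "(\<Sum>j\<in>UNIV. (cmod (W $ i $ j))\<^sup>2) = 1" "(\<Sum>i\<in>UNIV. (cmod (W $ i $ j))\<^sup>2) = 1"
proof -
  have "complex_of_real (\<Sum>j\<in>UNIV. (cmod (W $ i $ j))\<^sup>2) = (W ** mdagger W) $ i $ i"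
    by (simp add: matrix_mult_nth complex_norm_square del: of_real_power)
  then show "(\<Sum>j\<in>UNIV. (cmod (W $ i $ j))\<^sup>2) = 1"
    using assms by (simp only: unitary_matrixD mat_nth) (metis of_real_eq_1_iff)
  have "complex_of_real (\<Sum>i\<in>UNIV. (cmod (W $ i $ j))\<^sup>2) = (mdagger W ** W) $ j $ j"
    by (simp add: matrix_mult_nth complex_norm_square mult.commute del: of_real_power)
  then show "(\<Sum>i\<in>UNIV. (cmod (W $ i $ j))\<^sup>2) = 1"
    using assms by (simp only: unitary_matrixD mat_nth) (metis of_real_eq_1_iff)
qed

lemma overlap_same:
  assumes "unitary_matrix U"
  shows "overlap U U i j = (if i = j then 1 else 0)"
  by (simp add: overlap_def unitary_matrixD[OF assms] mat_nth)

lemma overlap_sums: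
  assumes "unitary_matrix U" "unitary_matrix V"
  shows "(\<Sum>i\<in>UNIV. \<Sum>j\<in>UNIV. overlap U V i j * x i) = (\<Sum>i\<in>UNIV. x i)"
    "(\<Sum>i\<in>UNIV. \<Sum>j\<in>UNIV. overlap U V i j * y j) = (\<Sum>j\<in>UNIV. y j)"
proof -
  have W: "unitary_matrix (mdagger U ** V)"
    using assms by (simp add: unitary_matrix_mult unitary_matrix_mdagger)
  show "(\<Sum>i\<in>UNIV. \<Sum>j\<in>UNIV. overlap U V i j * x i) = (\<Sum>i\<in>UNIV. x i)"
    unfolding overlap_def sum_distrib_right[symmetric] unitary_row_col_sums[OF W] by simp
  show "(\<Sum>i\<in>UNIV. \<Sum>j\<in>UNIV. overlap U V i j * y j) = (\<Sum>j\<in>UNIV. y j)"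
    by (subst sum.swap)
      (unfold overlap_def sum_distrib_right[symmetric] unitary_row_col_sums[OF W], simp)
qed

lemma trace_mult_diagonalizes:
  assumes "diagonalizes U a A" "diagonalizes V b B"
  shows "trace (A ** B) = complex_of_real (\<Sum>i\<in>UNIV. \<Sum>j\<in>UNIV. overlap U V i j * (a i * b j))"
proof -
  define W where "W = mdagger U ** V"
  have W': "mdagger W = mdagger V ** U" by (simp add: W_def mdagger_mult)
  have "trace (A ** B) = trace (U ** (real_diag a ** W ** real_diag b ** mdagger V))"
    using assms by (simp add: diagonalizes_def W_def matrix_mul_assoc)
  also have "\<dots> = trace (real_diag a ** (W ** real_diag b ** mdagger W))"
    by (subst trace_mul_sym) (simp add: W' matrix_mul_assoc)
  also have "\<dots> = (\<Sum>i\<in>UNIV. \<Sum>j\<in>UNIV. of_real (a i) * (W $ i $ j * of_real (b j) * cnj (W $ i $ j)))"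
    unfolding trace_def real_diag_matrix_mult_nth
    by (simp add: matrix_mult_nth[of "W ** real_diag b"] matrix_mult_real_diag_nth sum_distrib_left)
  also have "\<dots> = complex_of_real (\<Sum>i\<in>UNIV. \<Sum>j\<in>UNIV. overlap U V i j * (a i * b j))"
    unfolding overlap_def of_real_sum of_real_mult complex_norm_square W_def[symmetric]
    by (simp add: mult_ac)
  finally show ?thesis .
qed

lemma trace_mult_same_basis:
  assumes "diagonalizes U a A" "diagonalizes U b B"
  shows "trace (A ** B) = complex_of_real (\<Sum>i\<in>UNIV. a i * b i)"
proof -
  have "unitary_matrix U" using assms by (simp add: diagonalizes_def)
  then show ?thesis
    by (simp add: trace_mult_diagonalizes[OF assms] overlap_same if_distrib[of "\<lambda>x. x * _"]
        cong: if_cong)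
qed

lemma trace_mult_mlog_self:
  assumes "diagonalizes U a A"
  shows "trace (A ** mlog A) = complex_of_real (\<Sum>i\<in>UNIV. a i * ln0 (a i))"
  using trace_mult_same_basis[OF assms mlog_diagonalizes[OF assms]] by simp

subsection \<open>Klein's inequality\<close>

definition divergence :: "complex^'n^'n \<Rightarrow> complex^'n^'n \<Rightarrow> real" where
  "divergence A B = Re (trace (A ** mlog A) - trace (A ** mlog B))"

text \<open>Rows and columns of the overlaps sum to one, so the two traces can be distributed over
  the same double sum. Each summand then becomes a scalar Bregman divergence of x ln x, with a sign
  of its own when the eigenvalues permit it.\<close>

lemma divergence_expansion:
  assumes A: "diagonalizes U a A" and B: "diagonalizes V b B"
  shows "divergence A B - Re (trace A) + Re (trace B) =
    (\<Sum>i\<in>UNIV. \<Sum>j\<in>UNIV. overlap U V i j * (a i * ln0 (a i) - a i * ln0 (b j) - a i + b j))"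
proof -
  have UV: "unitary_matrix U" "unitary_matrix V" using A B by (simp_all add: diagonalizes_def)
  have "(\<Sum>i\<in>UNIV. \<Sum>j\<in>UNIV. overlap U V i j * (a i * ln0 (a i) - a i * ln0 (b j) - a i + b j))
      = (\<Sum>i\<in>UNIV. \<Sum>j\<in>UNIV. overlap U V i j * (a i * ln0 (a i)))
        - (\<Sum>i\<in>UNIV. \<Sum>j\<in>UNIV. overlap U V i j * (a i * ln0 (b j)))
        - (\<Sum>i\<in>UNIV. \<Sum>j\<in>UNIV. overlap U V i j * a i)
        + (\<Sum>i\<in>UNIV. \<Sum>j\<in>UNIV. overlap U V i j * b j)"
    by (simp add: distrib_left right_diff_distrib sum.distrib sum_subtractf)
  then show ?thesis
    unfolding divergence_def trace_mult_mlog_self[OF A] trace_diagonalizes[OF A]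
      trace_diagonalizes[OF B] trace_mult_diagonalizes[OF A mlog_diagonalizes[OF B]]
    by (simp add: overlap_sums[OF UV])
qed

text \<open>The unitarily rotated difference has entries \<open>W $ i $ j\<close> times a difference
  of eigenvalues. The same overlaps appear as in \<open>divergence_expansion\<close>, so the
  divergence and the distance can be compared term by term.\<close>

lemma norm_diff_expansion:
  assumes A: "diagonalizes U a A" and B: "diagonalizes V b B"
  shows "(norm (A - B))\<^sup>2 = (\<Sum>i\<in>UNIV. \<Sum>j\<in>UNIV. overlap U V i j * (a i - b j)\<^sup>2)"
proof -
  have U: "unitary_matrix U" and V: "unitary_matrix V" using A B by (simp_all add: diagonalizes_def)
  define W where "W = mdagger U ** V"
  define X where "X = mdagger U ** (A - B) ** V"
  have "trace (mdagger X ** X) = trace (mdagger V ** (mdagger (A - B) ** (A - B) ** V))"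
    using U by (simp add: X_def mdagger_mult flip: matrix_mul_assoc)
  also have "\<dots> = trace (mdagger (A - B) ** (A - B))"
    using V by (subst trace_mul_sym) (simp add: matrix_mul_assoc)
  finally have "(norm (A - B))\<^sup>2 = (norm X)\<^sup>2"
    by (metis norm_matrix_square of_real_eq_iff)
  also have "X = real_diag a ** W - W ** real_diag b"
    using A B by (simp add: X_def W_def diagonalizes_def matrix_mult_diff
        matrix_mul_assoc unitary_matrixD)
  also have "(norm \<dots>)\<^sup>2 = (\<Sum>i\<in>UNIV. \<Sum>j\<in>UNIV. (cmod (of_real (a i) * W $ i $ j - W $ i $ j * of_real (b j)))\<^sup>2)"
    by (simp add: norm_vec_def L2_set_def sum_nonneg matrix_mult_real_diag_nth
        real_diag_matrix_mult_nth)
  also have "\<dots> = (\<Sum>i\<in>UNIV. \<Sum>j\<in>UNIV. overlap U V i j * (a i - b j)\<^sup>2)"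
  proof (intro sum.cong refl)
    fix i j
    have "of_real (a i) * W $ i $ j - W $ i $ j * of_real (b j) = W $ i $ j * of_real (a i - b j)"
      by (simp add: algebra_simps)
    then show "(cmod (of_real (a i) * W $ i $ j - W $ i $ j * of_real (b j)))\<^sup>2
        = overlap U V i j * (a i - b j)\<^sup>2"
      by (simp add: norm_mult power_mult_distrib overlap_def W_def flip: of_real_diff)
  qed
  finally show ?thesis .
qed

text \<open>Both bounds are ln z \<le> z - 1: the lower one at z = y / x, with its equality case,
  the upper one at z = x / y.\<close>

lemma ln_tangent:
  fixes x y :: real
  assumes "0 \<le> x" "0 < y"
  shows ln_tangent_nonneg: "0 \<le> x * ln0 x - x * ln0 y - x + y"
    and ln_tangent_le: "x * ln0 x - x * ln0 y - x + y \<le> (x - y)\<^sup>2 / y"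
    and ln_tangent_eq_0: "x * ln0 x - x * ln0 y - x + y = 0 \<Longrightarrow> x = y"
proof -
  have *: "0 \<le> x * ln0 x - x * ln0 y - x + y \<and> x * ln0 x - x * ln0 y - x + y \<le> (x - y)\<^sup>2 / y \<and>
      (x * ln0 x - x * ln0 y - x + y = 0 \<longrightarrow> x = y)"
  proof (cases "x = 0")
    case True
    with assms show ?thesis by (simp add: power2_eq_square)
  next
    case False
    with assms have x: "0 < x" by simp
    have lower: "x * ln0 x - x * ln0 y - x + y = x * ((y / x - 1) - ln (y / x))"
      using x assms by (simp add: ln0_def ln_div field_simps)
    have "ln (x / y) \<le> x / y - 1" using x assms by (intro ln_le_minus_one) simp
    then have "x * ln (x / y) \<le> x * (x / y - 1)" using x by (intro mult_left_mono) auto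
    moreover have "x * ln0 x - x * ln0 y - x + y = x * ln (x / y) - x + y"
      using x assms by (simp add: ln0_def ln_div algebra_simps)
    moreover have "x * (x / y - 1) - x + y = (x - y)\<^sup>2 / y"
      using assms by (simp add: field_simps power2_eq_square)
    ultimately have upper: "x * ln0 x - x * ln0 y - x + y \<le> (x - y)\<^sup>2 / y"
      by linarith
    have "0 \<le> (y / x - 1) - ln (y / x)"
      using ln_le_minus_one[of "y / x"] x assms by simp
    moreover have "x = y" if "(y / x - 1) - ln (y / x) = 0"
      using ln_eq_minus_one[of "y / x"] x assms that by simp
    ultimately show ?thesis
      using x upper unfolding lower by (metis less_imp_le mult_eq_0_iff mult_nonneg_nonneg
          less_irrefl)
  qed
  then show "0 \<le> x * ln0 x - x * ln0 y - x + y"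
    "x * ln0 x - x * ln0 y - x + y \<le> (x - y)\<^sup>2 / y"
    "x * ln0 x - x * ln0 y - x + y = 0 \<Longrightarrow> x = y" by blast+
qed

text \<open>The traces are kept because the lemma is also applied to a reference shifted by a
  multiple of the identity, which is not normalized.\<close>

lemma klein_inequality:
  assumes "psd A" "posdef B"
  shows "Re (trace A) - Re (trace B) \<le> divergence A B"
proof -
  obtain U a where A: "diagonalizes U a A" "\<And>i. 0 \<le> a i" using psd_diagonalizable[OF assms(1)] by blast
  obtain V b where B: "diagonalizes V b B" "\<And>i. 0 < b i" using posdef_diagonalizable[OF assms(2)] by blast
  have "0 \<le> divergence A B - Re (trace A) + Re (trace B)"
    unfolding divergence_expansion[OF A(1) B(1)]
    by (intro sum_nonneg mult_nonneg_nonneg overlap_nonneg ln_tangent_nonneg A(2) B(2))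
  then show ?thesis by simp
qed

text \<open>Every scalar term must vanish, so eigenvalues agree wherever the eigenvectors overlap,
  and then the Hilbert-Schmidt distance is zero.\<close>

lemma klein_equality:
  assumes "psd A" "posdef B" "trace A = trace B" "divergence A B = 0"
  shows "A = B"
proof -
  obtain U a where A: "diagonalizes U a A" "\<And>i. 0 \<le> a i" using psd_diagonalizable[OF assms(1)] by blast
  obtain V b where B: "diagonalizes V b B" "\<And>i. 0 < b i" using posdef_diagonalizable[OF assms(2)] by blast
  let ?k = "\<lambda>i j. overlap U V i j * (a i * ln0 (a i) - a i * ln0 (b j) - a i + b j)"
  have pos: "0 \<le> ?k i j" for i j
    by (intro mult_nonneg_nonneg overlap_nonneg ln_tangent_nonneg A(2) B(2))
  have "(\<Sum>i\<in>UNIV. \<Sum>j\<in>UNIV. ?k i j) = 0"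
    using divergence_expansion[OF A(1) B(1)] assms(3,4) by simp
  then have "?k i j = 0" for i j
    using pos by (simp add: sum_nonneg_eq_0_iff sum_nonneg)
  then have "overlap U V i j = 0 \<or> a i = b j" for i j
    using ln_tangent_eq_0[OF A(2) B(2)] by (metis mult_eq_0_iff)
  then have z: "overlap U V i j * (a i - b j)\<^sup>2 = 0" for i j
    by (metis diff_self mult_zero_left mult_zero_right zero_power2)
  have "(norm (A - B))\<^sup>2 = 0"
    unfolding norm_diff_expansion[OF A(1) B(1)] z by simp
  then show ?thesis by simp
qed

text \<open>The constant is the inverse of the least eigenvalue of \<open>B\<close>. For equal
  traces the bound is quadratic in the displacement, so \<open>divergence A B\<close> contributes
  nothing to first-order variations at \<open>B\<close>.\<close>

lemma divergence_upper_bound: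
  assumes "posdef B"
  obtains c where "\<And>A. psd A \<Longrightarrow> divergence A B \<le> Re (trace A) - Re (trace B) + c * (norm (A - B))\<^sup>2"
proof -
  obtain V b where B: "diagonalizes V b B" "\<And>i. 0 < b i" using posdef_diagonalizable[OF assms] by blast
  define m where "m = Min (range b)"
  have m: "0 < m" "\<And>i. m \<le> b i" using B(2) by (auto simp: m_def)
  have "divergence A B \<le> Re (trace A) - Re (trace B) + (1 / m) * (norm (A - B))\<^sup>2" if A: "psd A" for A
  proof -
    obtain U a where A: "diagonalizes U a A" "\<And>i. 0 \<le> a i" using psd_diagonalizable[OF A] by blast
    have "a i * ln0 (a i) - a i * ln0 (b j) - a i + b j \<le> (1 / m) * (a i - b j)\<^sup>2" for i j
    proof -
      have "(a i - b j)\<^sup>2 / b j \<le> (a i - b j)\<^sup>2 / m"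
        using m B(2)[of j] by (intro divide_left_mono) auto
      with ln_tangent_le[OF A(2) B(2), of i j] show ?thesis by simp
    qed
    then have "divergence A B - Re (trace A) + Re (trace B)
        \<le> (\<Sum>i\<in>UNIV. \<Sum>j\<in>UNIV. overlap U V i j * ((1 / m) * (a i - b j)\<^sup>2))"
      unfolding divergence_expansion[OF A(1) B(1)]
      by (intro sum_mono mult_left_mono overlap_nonneg)
    also have "\<dots> = (1 / m) * (norm (A - B))\<^sup>2"
      unfolding norm_diff_expansion[OF A(1) B(1)] by (simp add: sum_distrib_left mult_ac)
    finally show ?thesis by simp
  qed
  then show ?thesis by (rule that)
qed

section \<open>Affine perturbations, positivity and supports\<close>

lemma diagonalizes_affine:
  assumes "diagonalizes U d A"
  shows "diagonalizes U (\<lambda>i. x * d i + y) (x *\<^sub>R A + y *\<^sub>R mat 1)"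
proof (rule diagonalizesI)
  show U: "unitary_matrix U" using assms by (simp add: diagonalizes_def)
  have "real_diag (\<lambda>i. x * d i + y) = x *\<^sub>R real_diag d + y *\<^sub>R mat 1"
    by (simp add: vec_eq_iff real_diag_nth mat_nth scaleR_conv_of_real[where 'a=complex])
  then show "x *\<^sub>R A + y *\<^sub>R mat 1 = U ** real_diag (\<lambda>i. x * d i + y) ** mdagger U"
    using assms
    by (simp add: diagonalizes_def matrix_add_ldistrib matrix_mult_add_left matrix_mult_scaleR
        unitary_matrixD)
qed

lemma psd_add: "psd A \<Longrightarrow> psd B \<Longrightarrow> psd (A + B)"
  by (simp add: psd_def matrix_vector_mult_add_rdistrib cinner_add_right)

lemma psd_scaleR: "psd A \<Longrightarrow> 0 \<le> r \<Longrightarrow> psd (r *\<^sub>R A)"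
  by (simp add: psd_def matrix_vector_mult_scaleR cinner_scaleR_right less_eq_complex_def)

lemma posdef_scaleR: "posdef A \<Longrightarrow> 0 < r \<Longrightarrow> posdef (r *\<^sub>R A)"
  by (simp add: posdef_def matrix_vector_mult_scaleR cinner_scaleR_right less_complex_def)

lemma posdef_add_psd: "posdef A \<Longrightarrow> psd B \<Longrightarrow> posdef (A + B)"
  by (simp add: posdef_def psd_def matrix_vector_mult_add_rdistrib cinner_add_right add_pos_nonneg
      less_complex_def less_eq_complex_def)

text \<open>Positive definite matrices are interior among Hermitian ones. Both signs of
  \<open>t\<close> are required, since stationarity is tested in both directions.\<close>

lemma posdef_perturb:
  assumes "posdef A" and H: "mdagger H = H"
  obtains t0 where "0 < t0" "\<And>t. \<bar>t\<bar> \<le> t0 \<Longrightarrow> psd (A + t *\<^sub>R H)"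
proof -
  obtain U a where A: "diagonalizes U a A" "\<And>i. 0 < a i"
    using posdef_diagonalizable[OF assms(1)] by blast
  obtain V h where V: "diagonalizes V h H"
    using hermitian_diagonalizable[OF H] .
  define m where "m = Min (range a)"
  \<comment> \<open>The added 1 keeps \<open>M\<close> positive when \<open>H\<close> is zero, so
    that \<open>m / M\<close> is a legitimate radius.\<close>
  define M where "M = Max (range (\<lambda>i. \<bar>h i\<bar>)) + 1"
  have m: "0 < m" "\<And>i. m \<le> a i" using A(2) by (auto simp: m_def)
  have "\<bar>h i\<bar> \<le> Max (range (\<lambda>i. \<bar>h i\<bar>))" for i by (rule Max_ge) auto
  then have "\<bar>h i\<bar> < M" for i unfolding M_def using less_add_one order.strict_trans1 by blast
  then have M1: "\<bar>h i\<bar> \<le> M" for i by (rule less_imp_le)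
  have M: "0 < M" using \<open>\<And>i. \<bar>h i\<bar> < M\<close>[of undefined] by linarith
  have "psd (A + t *\<^sub>R H)" if t: "\<bar>t\<bar> \<le> m / M" for t
  proof -
    have "0 \<le> Re (cinner v ((A + t *\<^sub>R H) *v v))" for v
    proof -
      have "- M * (norm v)\<^sup>2 \<le> Re (cinner v (H *v v))" "Re (cinner v (H *v v)) \<le> M * (norm v)\<^sup>2"
        using form_bounds[OF V, of "- M" M v] M1 by (auto simp: abs_le_iff minus_le_iff)
      then have "\<bar>Re (cinner v (H *v v))\<bar> \<le> M * (norm v)\<^sup>2" by (simp add: abs_le_iff)
      then have "\<bar>t * Re (cinner v (H *v v))\<bar> \<le> m / M * (M * (norm v)\<^sup>2)"
        unfolding abs_mult using t m(1) M by (intro mult_mono) auto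
      then have "\<bar>t * Re (cinner v (H *v v))\<bar> \<le> m * (norm v)\<^sup>2" using M by simp
      moreover have "m * (norm v)\<^sup>2 \<le> Re (cinner v (A *v v))"
        using form_bounds(1)[OF A(1) m(2), of "Max (range a)"] by simp
      ultimately show ?thesis
        by (simp add: matrix_vector_mult_add_rdistrib cinner_add_right matrix_vector_mult_scaleR
            cinner_scaleR_right)
    qed
    moreover have "mdagger (A + t *\<^sub>R H) = A + t *\<^sub>R H"
      by (simp add: mdagger_add mdagger_scaleR H posdef_imp_hermitian[OF assms(1)])
    ultimately show ?thesis by (simp add: psd_iff_Re)
  qed
  moreover have "0 < m / M" using m M by simp
  ultimately show ?thesis using that by blast
qed

lemma supp_posdef:
  assumes "posdef A"
  shows "supp A = UNIV"
proof -
  have ker: "w = 0" if "A *v w = 0" for w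
    using assms that unfolding posdef_def by (metis cinner_zero_right order.irrefl)
  have "v \<in> supp A" for v
    unfolding supp_def by (auto dest!: ker)
  then show ?thesis by blast
qed

lemma rel_entropy_posdef_right: "posdef B \<Longrightarrow> rel_entropy A B = ereal (divergence A B)"
  by (simp add: rel_entropy_def supp_posdef divergence_def)

text \<open>A kernel vector of \<open>B\<close> lying in \<open>supp B\<close> would be orthogonal
  to itself, whereas \<open>supp A\<close> is the whole space.\<close>

lemma rel_entropy_singular:
  assumes "posdef A" "psd B" "\<not> posdef B"
  shows "rel_entropy A B = \<infinity>"
proof -
  obtain U b where B: "diagonalizes U b B" "\<And>i. 0 \<le> b i"
    using psd_diagonalizable[OF assms(2)] by blast
  then obtain i where "b i = 0"
    using assms(3) by (metis posdef_iff_eigenvalues less_eq_real_def)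
  have U: "unitary_matrix U" using B by (simp add: diagonalizes_def)
  have "B *v (U *v axis i 1) = U *v (real_diag b *v (mdagger U *v (U *v axis i 1)))"
    using B by (simp add: diagonalizes_def matrix_vector_mul_assoc matrix_mul_assoc)
  also have "mdagger U *v (U *v axis i 1) = axis i 1"
    by (simp add: matrix_vector_mul_assoc unitary_matrixD[OF U])
  also have "real_diag b *v axis i 1 = 0"
    using \<open>b i = 0\<close> by (simp add: vec_eq_iff real_diag_nth)
  finally have ker: "B *v (U *v axis i 1) = 0" by simp
  have "cinner (U *v axis i 1) (U *v axis i 1) \<noteq> 0"
    by (simp add: cinner_self norm_unitary_mult[OF U])
  with ker have "U *v axis i 1 \<notin> supp B" by (auto simp: supp_def)
  then show ?thesis by (auto simp: rel_entropy_def supp_posdef[OF assms(1)])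
qed

subsection \<open>Minimizing over the first argument\<close>

text \<open>The term tr (A log A) cancels between two references, leaving something linear in
  \<open>A\<close>. Both Pythagorean identities rest on this.\<close>

lemma divergence_change_reference:
  "divergence A C = divergence A B + Re (trace (A ** (mlog B - mlog C)))"
  by (simp add: divergence_def matrix_mult_diff trace_sub)

text \<open>The eigenvalues lie in [0,1] and sum to one, so their squares sum to at most one. This
  supplies the boundedness for compactness.\<close>

lemma norm_state_le_1:
  assumes "psd A" "trace A = 1"
  shows "norm A \<le> 1"
proof -
  obtain U a where A: "diagonalizes U a A" "\<And>i. 0 \<le> a i"
    using psd_diagonalizable[OF assms(1)] by blast
  have sum: "(\<Sum>i\<in>UNIV. a i) = 1"
    using trace_diagonalizes[OF A(1)] assms(2) by (metis of_real_eq_1_iff)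
  have "complex_of_real ((norm A)\<^sup>2) = complex_of_real (\<Sum>i\<in>UNIV. a i * a i)"
    unfolding norm_matrix_square psd_imp_hermitian[OF assms(1)]
    by (rule trace_mult_same_basis[OF A(1) A(1)])
  then have "(norm A)\<^sup>2 = (\<Sum>i\<in>UNIV. a i * a i)" by (simp only: of_real_eq_iff)
  also have "\<dots> \<le> (\<Sum>i\<in>UNIV. 1 * a i)"
  proof (intro sum_mono mult_right_mono A(2))
    show "a i \<le> 1" for i
      using member_le_sum[of i UNIV a] A(2) sum by simp
  qed
  finally show ?thesis using sum by (simp add: power_le_one_iff abs_square_le_1)
qed

lemma closed_psd: "closed {A :: complex^'n^'n. psd A}"
proof -
  have "{A :: complex^'n^'n. psd A} = {A. \<forall>v. 0 \<le> Re (cinner v (A *v v)) \<and> Im (cinner v (A *v v)) = 0}"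
    by (auto simp: psd_def less_eq_complex_def)
  moreover have "closed \<dots>"
    by (intro closed_Collect_all closed_Collect_conj closed_Collect_le closed_Collect_eq
        continuous_intros)
  ultimately show ?thesis by simp
qed

lemma compact_states:
  fixes L :: "(complex^'n^'n) set"
  assumes "affine L" "\<And>A. A \<in> L \<Longrightarrow> trace A = 1"
  shows "compact {A \<in> L. psd A}"
proof -
  have "closed (L \<inter> {A. psd A})"
    by (intro closed_Int closed_psd affine_closed assms(1))
  moreover have "bounded (L \<inter> {A. psd A})"
    using norm_state_le_1 assms(2) by (intro boundedI[of _ 1]) auto
  ultimately show ?thesis by (simp add: compact_eq_bounded_closed Int_def)
qed

text \<open>Lower semicontinuity of \<open>A \<mapsto> tr (A log A)\<close> comes from Klein's inequality with reference
  \<open>l + \<epsilon>\<close>: it bounds \<open>tr (A log A)\<close> from below by an affine function of \<open>A\<close> whose value at \<open>l\<close> is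
  at least \<open>tr (l log l) - \<epsilon> D\<close>, with \<open>D\<close> the dimension.\<close>

lemma divergence_minimizer_exists:
  fixes K :: "(complex^'n^'n) set"
  assumes K: "compact K" "K \<noteq> {}" and state: "\<And>A. A \<in> K \<Longrightarrow> psd A \<and> trace A = 1"
    and B: "posdef B"
  obtains A where "A \<in> K" "\<And>A'. A' \<in> K \<Longrightarrow> divergence A B \<le> divergence A' B"
proof -
  define S where "S = (\<lambda>A. divergence A B) ` K"
  define m where "m = Inf S"
  have "1 - Re (trace B) \<le> divergence A B" if "A \<in> K" for A
    using klein_inequality[OF _ B, of A] state[OF that] by simp
  then have "bdd_below S" unfolding S_def by (rule bdd_belowI2)
  have m_le: "m \<le> divergence A B" if "A \<in> K" for A
    unfolding m_def using that \<open>bdd_below S\<close> by (intro cInf_lower) (auto simp: S_def)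
  have "\<exists>A\<in>K. divergence A B < m + inverse (real (Suc n))" for n
  proof -
    have "S \<noteq> {}" using K by (simp add: S_def)
    moreover have "Inf S < m + inverse (real (Suc n))" by (simp add: m_def)
    ultimately have "\<exists>x\<in>S. x < m + inverse (real (Suc n))" by (rule cInf_lessD)
    then show ?thesis by (simp add: S_def)
  qed
  then have "\<forall>n. \<exists>A. A \<in> K \<and> divergence A B < m + inverse (real (Suc n))" by blast
  from choice[OF this] obtain X
    where X: "\<And>n. X n \<in> K" "\<And>n. divergence (X n) B < m + inverse (real (Suc n))"
    by blast
  obtain l r where l: "l \<in> K" and r: "strict_mono r" and lim: "(X \<circ> r) \<longlonglongrightarrow> l"
    using seq_compactE[of K X] K(1) X(1) by (auto simp: compact_eq_seq_compact_metric)
  have "psd l" "trace l = 1" using state[OF l] by auto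
  obtain U d where d: "diagonalizes U d l" "\<And>i. 0 \<le> d i"
    using psd_diagonalizable[OF \<open>psd l\<close>] by blast
  have bound: "divergence l B \<le> m + \<epsilon> * CARD('n)" if "0 < \<epsilon>" for \<epsilon> :: real
  proof -
    define C where "C = l + \<epsilon> *\<^sub>R mat 1"
    have C: "diagonalizes U (\<lambda>i. d i + \<epsilon>) C"
      using diagonalizes_affine[OF d(1), of 1 \<epsilon>] by (simp add: C_def)
    have "posdef C"
      unfolding posdef_iff_eigenvalues[OF C] using d(2) that by (simp add: add_nonneg_pos)
    have trC: "Re (trace C) = 1 + \<epsilon> * CARD('n)"
      by (simp add: C_def trace_add trace_scaleR trace_I \<open>trace l = 1\<close>)
    \<comment> \<open>The logarithms are of fixed matrices, so \<open>G\<close> is continuous and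
      passes to the limit. The subtracted constant is \<open>trace C - 1\<close>, from Klein's
      inequality.\<close>
    define G where "G A = Re (trace (A ** (mlog C - mlog B))) - \<epsilon> * CARD('n)" for A
    have G_le: "G A \<le> divergence A B" if "A \<in> K" for A
      using klein_inequality[OF _ \<open>posdef C\<close>, of A] state[OF that] trC
        divergence_change_reference[of A B C] by (simp add: G_def)
    have "continuous_on UNIV G"
      unfolding G_def by (intro continuous_intros)
    then have lim1: "(\<lambda>n. G ((X \<circ> r) n)) \<longlonglongrightarrow> G l"
      by (rule continuous_on_tendsto_compose[OF _ lim]) auto
    have lim2: "(\<lambda>n. m + inverse (real (Suc (r n)))) \<longlonglongrightarrow> m + 0"
      using LIMSEQ_subseq_LIMSEQ[OF LIMSEQ_inverse_real_of_nat r]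
      by (intro tendsto_intros) (simp add: o_def)
    have "G ((X \<circ> r) n) \<le> m + inverse (real (Suc (r n)))" for n
      using G_le[OF X(1)[of "r n"]] X(2)[of "r n"] by simp
    then have "G l \<le> m + 0" by (intro LIMSEQ_le[OF lim1 lim2]) blast
    \<comment> \<open>\<open>l\<close> and \<open>C\<close> share an eigenbasis, so monotonicity of
      ln applies eigenvalue by eigenvalue; a zero eigenvalue contributes 0 to both sides.\<close>
    moreover have "Re (trace (l ** mlog l)) \<le> Re (trace (l ** mlog C))"
    proof -
      have "d i * ln0 (d i) \<le> d i * ln0 (d i + \<epsilon>)" for i
        using d(2)[of i] that by (auto simp: ln0_def intro!: mult_left_mono)
      then show ?thesis
        unfolding trace_mult_same_basis[OF d(1) mlog_diagonalizes[OF d(1)]]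
          trace_mult_same_basis[OF d(1) mlog_diagonalizes[OF C]] Re_complex_of_real o_def
        by (intro sum_mono)
    qed
    ultimately show ?thesis
      by (simp add: G_def divergence_def matrix_mult_diff trace_sub)
  qed
  have "divergence l B \<le> m"
  proof (rule field_le_epsilon)
    fix e :: real assume "0 < e"
    then show "divergence l B \<le> m + e" using bound[of "e / real CARD('n)"] by simp
  qed
  with m_le show ?thesis using that[OF l] order.trans by blast
qed

text \<open>The slope of \<open>x \<mapsto> x ln x\<close> at \<open>0\<close> is \<open>-\<infinity>\<close>, so mixing a singular state with the maximally mixed one
  decreases the divergence at first.\<close>

lemma divergence_minimizer_posdef:
  fixes K :: "(complex^'n^'n) set"
  defines "P \<equiv> (1 / CARD('n)) *\<^sub>R mat 1"
  assumes B: "posdef B" and A: "psd A" "trace A = 1"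
    and mix: "\<And>t. 0 < t \<Longrightarrow> t < 1 \<Longrightarrow> (1 - t) *\<^sub>R A + t *\<^sub>R P \<in> K"
    and min: "\<And>A'. A' \<in> K \<Longrightarrow> divergence A B \<le> divergence A' B"
  shows "posdef A"
proof (rule ccontr)
  assume "\<not> posdef A"
  define p where "p = 1 / real CARD('n)"
  have p: "0 < p" by (simp add: p_def)
  obtain U a where a: "diagonalizes U a A" "\<And>i. 0 \<le> a i"
    using psd_diagonalizable[OF A(1)] by blast
  with \<open>\<not> posdef A\<close> obtain k where k: "a k = 0"
    by (metis posdef_iff_eigenvalues less_eq_real_def)
  have P: "diagonalizes U (\<lambda>i. p) P"
    using diagonalizes_affine[OF a(1), of 0 p] by (simp add: P_def p_def)
  define D where "D = divergence P B - divergence A B"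
  have step: "0 \<le> D + p * ln t" if t: "0 < t" "t < 1" for t
  proof -
    define T where "T = (1 - t) *\<^sub>R A + t *\<^sub>R P"
    have T: "diagonalizes U (\<lambda>i. (1 - t) * a i + t * p) T"
      using diagonalizes_affine[OF a(1), of "1 - t" "t * p"] by (simp add: T_def P_def p_def)
    let ?h = "\<lambda>x. x * ln0 x"
    have h: "?h ((1 - t) * a i + t * p) \<le> (1 - t) * ?h (a i) + t * ?h p" for i
    proof -
      let ?y = "(1 - t) * a i + t * p"
      have y: "0 < ?y" using a(2)[of i] t p by (intro add_nonneg_pos) auto
      \<comment> \<open>Convexity of x ln x from two tangent inequalities at the mixture
        \<open>?y\<close>: with weights 1 - t and t their linear parts cancel.\<close>
      have "0 \<le> (1 - t) * (a i * ln0 (a i) - a i * ln0 ?y - a i + ?y)"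
        using t ln_tangent_nonneg[OF a(2) y] by (intro mult_nonneg_nonneg) auto
      moreover have "0 \<le> t * (p * ln0 p - p * ln0 ?y - p + ?y)"
        using t p ln_tangent_nonneg[OF _ y, of p] by (intro mult_nonneg_nonneg) auto
      ultimately have "0 \<le> (1 - t) * (a i * ln0 (a i) - a i * ln0 ?y - a i + ?y)
          + t * (p * ln0 p - p * ln0 ?y - p + ?y)" by (rule add_nonneg_nonneg)
      also have "\<dots> = (1 - t) * ?h (a i) + t * ?h p - ?h ?y"
        by (simp only: algebra_simps)
      finally show ?thesis by simp
    qed
    \<comment> \<open>At the zero eigenvalue the logarithm of t p splits exactly, leaving the
      negative term t p ln t. Divided by t it is unbounded below as t tends to 0.\<close>
    have hk: "?h ((1 - t) * a k + t * p) = (1 - t) * ?h (a k) + t * ?h p + t * p * ln t"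
      using t p by (simp add: k ln0_def ln_mult algebra_simps)
    have "(\<Sum>i\<in>UNIV. ?h ((1 - t) * a i + t * p))
        \<le> (\<Sum>i\<in>UNIV. (1 - t) * ?h (a i) + t * ?h p + (if i = k then t * p * ln t else 0))"
      using h hk by (intro sum_mono) auto
    also have "\<dots> = (1 - t) * (\<Sum>i\<in>UNIV. ?h (a i)) + t * (\<Sum>i\<in>(UNIV::'n set). ?h p) + t * p * ln t"
      by (simp add: sum.distrib sum_distrib_left)
    finally have "Re (trace (T ** mlog T))
        \<le> (1 - t) * Re (trace (A ** mlog A)) + t * Re (trace (P ** mlog P)) + t * p * ln t"
      unfolding trace_mult_mlog_self[OF T] trace_mult_mlog_self[OF a(1)]
        trace_mult_mlog_self[OF P] by simp
    moreover have "Re (trace (T ** mlog B)) = (1 - t) * Re (trace (A ** mlog B)) + t * Re (trace (P ** mlog B))"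
      by (simp add: T_def matrix_mult_add_left trace_add trace_scaleR matrix_mult_scaleR)
    ultimately have "divergence T B
        \<le> (1 - t) * divergence A B + t * divergence P B + t * p * ln t"
      by (simp add: divergence_def algebra_simps)
    moreover have "divergence A B \<le> divergence T B"
      using mix[OF t] by (intro min) (simp add: T_def)
    ultimately have "0 \<le> t * (D + p * ln t)"
      by (simp add: D_def algebra_simps)
    with t(1) show ?thesis by (simp add: zero_le_mult_iff)
  qed
  \<comment> \<open>Chosen so that p ln t = -(\<bar>D\<bar> + 1), which makes D + p ln t at most
    -1.\<close>
  define t where "t = exp (- (\<bar>D\<bar> + 1) / p)"
  have "t < 1" "0 < t" using p by (simp_all add: t_def divide_neg_pos)
  moreover have "p * ln t = - (\<bar>D\<bar> + 1)" using p by (simp add: t_def)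
  ultimately show False using step[of t] by simp
qed

text \<open>Stationarity at \<open>A\<close>: along the line through \<open>A\<close> and \<open>A'\<close> the divergence from \<open>B\<close> is a linear term
  plus \<open>divergence X A\<close>, and the latter is quadratically small.\<close>

lemma divergence_pythagoras:
  assumes L: "affine L" "\<And>A. A \<in> L \<Longrightarrow> trace A = 1"
    and B: "posdef B" and A: "A \<in> L" "posdef A"
    and min: "\<And>X. X \<in> L \<Longrightarrow> psd X \<Longrightarrow> divergence A B \<le> divergence X B"
    and A': "A' \<in> L" "mdagger A' = A'"
  shows "divergence A' B = divergence A' A + divergence A B"
proof -
  define H where "H = A' - A"
  define c where "c = Re (trace (H ** (mlog A - mlog B)))"
  have H: "mdagger H = H" by (simp add: H_def mdagger_diff A'(2) posdef_imp_hermitian[OF A(2)])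
  obtain t0 where t0: "0 < t0" "\<And>t. \<bar>t\<bar> \<le> t0 \<Longrightarrow> psd (A + t *\<^sub>R H)"
    using posdef_perturb[OF A(2) H] by blast
  obtain k where k: "\<And>X. psd X \<Longrightarrow> divergence X A \<le> Re (trace X) - Re (trace A) + k * (norm (X - A))\<^sup>2"
    using divergence_upper_bound[OF A(2)] by blast
  have key: "0 \<le> t * c + t\<^sup>2 * (k * (norm H)\<^sup>2)" if "\<bar>t\<bar> \<le> t0" for t
  proof -
    define X where "X = A + t *\<^sub>R H"
    have "X = (1 - t) *\<^sub>R A + t *\<^sub>R A'" by (simp add: X_def H_def algebra_simps)
    then have "X \<in> L" using L(1) A(1) A'(1) by (simp add: mem_affine)
    have "psd X" using t0(2)[OF that] by (simp add: X_def)
    have "divergence A B \<le> divergence X B" by (rule min) fact+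
    also have "\<dots> = divergence X A + Re (trace (X ** (mlog A - mlog B)))"
      by (rule divergence_change_reference)
    also have "Re (trace (X ** (mlog A - mlog B))) = divergence A B + t * c"
      by (simp add: X_def c_def matrix_mult_add_left trace_add matrix_mult_scaleR trace_scaleR
          divergence_change_reference[of A B A]) (simp add: divergence_def)
    also have "divergence X A \<le> t\<^sup>2 * (k * (norm H)\<^sup>2)"
      using k[OF \<open>psd X\<close>] L(2)[OF \<open>X \<in> L\<close>] L(2)[OF A(1)]
      by (simp add: X_def power_mult_distrib mult_ac)
    finally show ?thesis by simp
  qed
  have "c = 0"
  proof (rule ccontr)
    assume "c \<noteq> 0"
    \<comment> \<open>The bound \<bar>c\<bar> / (2 q) on \<open>s\<close> keeps the quadratic term
      within half of the linear one; the 1 makes \<open>q\<close> positive even if the quadratic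
      coefficient is zero.\<close>
    define q where "q = \<bar>k * (norm H)\<^sup>2\<bar> + 1"
    define s where "s = min t0 (\<bar>c\<bar> / (2 * q))"
    have q: "0 < q" by (simp add: q_def add_nonneg_pos)
    have s: "0 < s" "s \<le> t0" using t0 \<open>c \<noteq> 0\<close> q by (auto simp: s_def)
    have "s * q \<le> \<bar>c\<bar> / 2"
      using q by (simp add: s_def min_def field_simps)
    moreover have "s * (k * (norm H)\<^sup>2) \<le> s * q"
      using s by (intro mult_left_mono) (auto simp: q_def)
    ultimately have "s * (k * (norm H)\<^sup>2) - \<bar>c\<bar> < 0" using \<open>c \<noteq> 0\<close> by linarith
    then have "s * (s * (k * (norm H)\<^sup>2) - \<bar>c\<bar>) < 0" using s(1) by (simp add: mult_pos_neg)
    \<comment> \<open>The sign of the displacement is chosen against that of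
      \<open>c\<close>.\<close>
    moreover have "0 \<le> s * (s * (k * (norm H)\<^sup>2) - \<bar>c\<bar>)"
    proof (cases "0 < c")
      case True
      with key[of "- s"] s show ?thesis by (simp add: algebra_simps power2_eq_square)
    next
      case False
      with key[of s] s show ?thesis by (simp add: algebra_simps power2_eq_square)
    qed
    ultimately show False by simp
  qed
  \<comment> \<open>Zero slope means that this linear functional takes one value along the line
    through \<open>A\<close> and \<open>A'\<close>; at \<open>A\<close> that value is
    \<open>divergence A B\<close>.\<close>
  then have "Re (trace (A' ** (mlog A - mlog B))) = Re (trace (A ** (mlog A - mlog B)))"
    by (simp add: c_def H_def matrix_mult_diff(1) trace_sub)
  also have "\<dots> = divergence A B"
    by (simp add: divergence_def matrix_mult_diff trace_sub)
  finally show ?thesis using divergence_change_reference[of A' B A] by simp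
qed

subsection \<open>Minimizing over the second argument: symmetrization\<close>

text \<open>Common ground of unitary involutions and the spin flip, which reverses products. In
  \<open>spectral\<close> the new eigenbasis \<open>V\<close> does not depend on the eigenvalues, so
  a matrix and its logarithm are carried to the same basis and \<open>T\<close> commutes with
  \<open>mlog\<close>.\<close>

locale spectral_symmetry =
  fixes T :: "complex^'n^'n \<Rightarrow> complex^'n^'n"
  assumes linear: "linear T"
    and involution: "T (T X) = X"
    and selfadjoint: "trace (T X ** Y) = trace (X ** T Y)"
    and spectral: "unitary_matrix U \<Longrightarrow>
      \<exists>V. unitary_matrix V \<and> (\<forall>d. T (U ** real_diag d ** mdagger U) = V ** real_diag d ** mdagger V)"
begin

text \<open>On Hermitian matrices this is the Hilbert-Schmidt orthogonal projection onto the fixed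
  points, \<open>T\<close> being a self-adjoint involution.\<close>

definition symmetrization :: "complex^'n^'n \<Rightarrow> complex^'n^'n" where
  "symmetrization X = (1 / 2) *\<^sub>R (X + T X)"

lemma T_symmetrization: "T (symmetrization X) = symmetrization X"
  by (simp add: symmetrization_def linear_cmul[OF linear] linear_add[OF linear] involution
      add.commute)

lemma T_diagonalizes:
  assumes "diagonalizes U d X"
  obtains V where "diagonalizes V d (T X)" "diagonalizes V (ln0 \<circ> d) (T (mlog X))"
proof -
  obtain V where V: "unitary_matrix V"
    "\<And>d. T (U ** real_diag d ** mdagger U) = V ** real_diag d ** mdagger V"
    using spectral[of U] assms by (auto simp: diagonalizes_def)
  then have "diagonalizes V d (T X)" "diagonalizes V (ln0 \<circ> d) (T (mlog X))"
    using assms mlog_diagonalizes[OF assms] by (auto simp: diagonalizes_def)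
  then show ?thesis by (rule that)
qed

lemma T_mlog:
  assumes "mdagger X = X"
  shows "T (mlog X) = mlog (T X)"
proof -
  obtain U d where "diagonalizes U d X" using hermitian_diagonalizable[OF assms] .
  then obtain V where "diagonalizes V d (T X)" "diagonalizes V (ln0 \<circ> d) (T (mlog X))"
    by (rule T_diagonalizes)
  then show ?thesis using mlog_diagonalizes by (metis diagonalizes_def)
qed

lemma T_psd:
  assumes "psd X"
  shows "psd (T X)"
proof -
  obtain U d where "diagonalizes U d X" "\<And>i. 0 \<le> d i"
    using psd_diagonalizable[OF assms] by blast
  then show ?thesis by (metis T_diagonalizes psd_iff_eigenvalues)
qed

lemma posdef_symmetrization: "posdef X \<Longrightarrow> posdef (symmetrization X)"
  by (simp add: symmetrization_def posdef_scaleR posdef_add_psd T_psd posdef_imp_psd)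

text \<open>The difference \<open>G\<close> of the logarithms is fixed by \<open>T\<close>, and a
  fixed matrix has the same trace pairing with \<open>A\<close>, with \<open>T A\<close> and hence
  with their average.\<close>

lemma divergence_symmetrization:
  assumes "posdef A" "mdagger X = X" "T X = X"
  shows "divergence A X = divergence A (symmetrization A) + divergence (symmetrization A) X"
proof -
  let ?S = "symmetrization A"
  define G where "G = mlog ?S - mlog X"
  have "T (mlog ?S) = mlog ?S" "T (mlog X) = mlog X"
    using T_mlog[of ?S] T_mlog[of X] assms
    by (simp_all add: T_symmetrization posdef_imp_hermitian[OF posdef_symmetrization])
  then have "T G = G" by (simp add: G_def linear_diff[OF linear])
  then have "trace (T A ** G) = trace (A ** G)" by (simp add: selfadjoint)
  then have "trace (?S ** G) = trace (A ** G)"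
    by (simp add: symmetrization_def matrix_mult_scaleR trace_scaleR matrix_mult_add_left trace_add
        scaleR_2[symmetric])
  moreover have "divergence ?S X = Re (trace (?S ** G))"
    by (simp add: divergence_def G_def matrix_mult_diff trace_sub)
  ultimately show ?thesis
    using divergence_change_reference[of A X ?S] by (simp add: G_def)
qed

lemma rel_entropy_symmetrization:
  assumes "posdef A" "psd X" "T X = X"
  shows "rel_entropy A X = rel_entropy A (symmetrization A) + rel_entropy (symmetrization A) X"
proof (cases "posdef X")
  case True
  with assms show ?thesis
    by (simp add: rel_entropy_posdef_right posdef_symmetrization divergence_symmetrization
        psd_imp_hermitian)
next
  \<comment> \<open>Both sides are infinite: \<open>A\<close> and its symmetrization are positive
    definite while \<open>X\<close> is singular.\<close>
  case False
  with assms show ?thesis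
    by (simp add: rel_entropy_singular rel_entropy_posdef_right posdef_symmetrization)
qed

end

lemma rel_entropy_nonneg:
  assumes "posdef A" "psd X" "trace A = trace X"
  shows "0 \<le> rel_entropy A X"
  using assms klein_inequality[of A X]
  by (cases "posdef X") (simp_all add: rel_entropy_posdef_right rel_entropy_singular posdef_imp_psd)

lemma rel_entropy_eq_0:
  assumes "posdef A" "psd X" "trace A = trace X" "rel_entropy A X = 0"
  shows "X = A"
  using assms klein_equality[of A X]
  by (cases "posdef X") (auto simp: rel_entropy_posdef_right rel_entropy_singular posdef_imp_psd)

subsection \<open>Choi matrices of channels\<close>

abbreviation munit :: "'n \<Rightarrow> 'n \<Rightarrow> complex^'n^'n" where
  "munit i j \<equiv> ketbra (axis i 1) (axis j 1)"

lemma munit_nth: "munit i j $ a $ b = (if a = i \<and> b = j then 1 else 0)"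
  by (auto simp: axis_def)

lemma trace_munit: "trace (munit i j) = (if i = j then 1 else 0)"
  unfolding trace_def munit_nth by (cases "i = j") (auto intro: sum.neutral)

lemma cscale_nth [simp]: "cscale c A $ i $ j = c * A $ i $ j"
  by (simp add: cscale_def)

lemma sum_pair_UNIV:
  "(\<Sum>x\<in>UNIV. f x) = (\<Sum>a\<in>UNIV. \<Sum>i\<in>UNIV. f (a, i))"
  by (simp add: sum.cartesian_product)

lemma choi_nth:
  fixes \<E> :: "'n::finite superop"
  shows "choi \<E> $ (a, i) $ (b, j) = \<E> (munit i j) $ a $ b / of_nat CARD('n)"
proof -
  have "choi \<E> $ (a, i) $ (b, j)
      = (\<Sum>k\<in>UNIV. \<Sum>l\<in>UNIV. \<E> (munit k l) $ a $ b * munit k l $ i $ j) / of_nat CARD('n)"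
    by (simp add: choi_def tensor_def)
  also have "\<dots> = (\<Sum>k\<in>UNIV. \<Sum>l\<in>UNIV. if l = j then if k = i then \<E> (munit k l) $ a $ b else 0 else 0)
      / of_nat CARD('n)"
    unfolding munit_nth by (intro arg_cong2[where f = "(/)"] sum.cong refl) auto
  finally show ?thesis by simp
qed

lemma linear_superop_sum:
  assumes "linear_superop \<E>"
  shows "\<E> (sum f S) = (\<Sum>s\<in>S. \<E> (f s))"
proof -
  have "\<E> 0 = 0"
    using assms[unfolded linear_superop_def, THEN conjunct2, rule_format, of 0 0]
    by (simp add: cscale_def vec_eq_iff zero_vec_def)
  then show ?thesis
    using assms by (induction S rule: infinite_finite_induct) (auto simp: linear_superop_def)
qed

lemma linear_superop_nth:
  assumes "linear_superop \<E>"
  shows "\<E> X $ a $ b = (\<Sum>i\<in>UNIV. \<Sum>j\<in>UNIV. X $ i $ j * \<E> (munit i j) $ a $ b)"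
proof -
  have "X $ a $ b = (\<Sum>i\<in>UNIV. \<Sum>j\<in>UNIV. cscale (X $ i $ j) (munit i j)) $ a $ b" for a b
  proof -
    have "(\<Sum>i\<in>UNIV. \<Sum>j\<in>UNIV. cscale (X $ i $ j) (munit i j)) $ a $ b
        = (\<Sum>i\<in>UNIV. \<Sum>j\<in>UNIV. if j = b then if i = a then X $ i $ j else 0 else 0)"
      unfolding sum_component cscale_nth munit_nth by (intro sum.cong refl) auto
    then show ?thesis by simp
  qed
  then have "X = (\<Sum>i\<in>UNIV. \<Sum>j\<in>UNIV. cscale (X $ i $ j) (munit i j))"
    by (subst vec_eq_iff, subst vec_eq_iff) blast
  then have "\<E> X = \<E> (\<Sum>i\<in>UNIV. \<Sum>j\<in>UNIV. cscale (X $ i $ j) (munit i j))"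
    by (rule arg_cong)
  also have "\<dots> = (\<Sum>i\<in>UNIV. \<Sum>j\<in>UNIV. cscale (X $ i $ j) (\<E> (munit i j)))"
    using assms by (simp add: linear_superop_sum[OF assms] linear_superop_def)
  finally show ?thesis by simp
qed

text \<open>Inverse of \<open>choi\<close> on linear maps; the factor \<open>CARD('n)\<close> undoes
  the normalization. It turns matrix minimizers back into channels.\<close>

definition unchoi :: "complex^('n::finite \<times> 'n)^('n \<times> 'n) \<Rightarrow> 'n::finite superop" where
  "unchoi J X = (\<chi> a b. \<Sum>i\<in>UNIV. \<Sum>j\<in>UNIV. X $ i $ j * (of_nat CARD('n) * J $ (a, i) $ (b, j)))"

lemma linear_unchoi: "linear_superop (unchoi J)"
  by (simp add: linear_superop_def unchoi_def vec_eq_iff distrib_right sum.distrib sum_distrib_left mult.assoc)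

lemma unchoi_choi: "linear_superop \<E> \<Longrightarrow> unchoi (choi \<E>) = \<E>"
  by (simp add: fun_eq_iff vec_eq_iff unchoi_def choi_nth linear_superop_nth[of \<E>])

lemma unchoi_munit:
  fixes J :: "complex^('n::finite \<times> 'n)^('n \<times> 'n)"
  shows "unchoi J (munit i j) $ a $ b = of_nat CARD('n) * J $ (a, i) $ (b, j)"
proof -
  have "unchoi J (munit i j) $ a $ b
      = (\<Sum>k\<in>UNIV. \<Sum>l\<in>UNIV. if l = j then if k = i then of_nat CARD('n) * J $ (a, k) $ (b, l) else 0 else 0)"
    unfolding unchoi_def munit_nth vec_lambda_beta by (intro sum.cong refl) auto
  then show ?thesis by simp
qed

lemma choi_unchoi: "choi (unchoi J) = J"
  by (simp add: vec_eq_iff choi_nth unchoi_munit)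

lemma choi_inject: "linear_superop \<E> \<Longrightarrow> linear_superop \<F> \<Longrightarrow> choi \<E> = choi \<F> \<Longrightarrow> \<E> = \<F>"
  by (metis unchoi_choi)

text \<open>In a pair index the first component is the output and the second the input. The
  condition fixes the input marginal, the partial trace over the output, to be maximally mixed;
  \<open>choi_unital\<close> does the same for the output marginal.\<close>

definition choi_tp :: "complex^('n::finite \<times> 'n)^('n \<times> 'n) \<Rightarrow> bool" where
  "choi_tp J \<longleftrightarrow> (\<forall>i j. (\<Sum>a\<in>UNIV. J $ (a, i) $ (a, j)) = (if i = j then 1 / of_nat CARD('n) else 0))"

definition choi_unital :: "complex^('n::finite \<times> 'n)^('n \<times> 'n) \<Rightarrow> bool" where
  "choi_unital J \<longleftrightarrow> (\<forall>a b. (\<Sum>i\<in>UNIV. J $ (a, i) $ (b, i)) = (if a = b then 1 / of_nat CARD('n) else 0))"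

lemma choi_tp_iff:
  assumes "linear_superop \<E>"
  shows "choi_tp (choi \<E>) \<longleftrightarrow> (\<forall>X. trace (\<E> X) = trace X)"
proof
  assume "\<forall>X. trace (\<E> X) = trace X"
  then have "trace (\<E> (munit i j)) = (if i = j then 1 else 0)" for i j
    by (simp add: trace_munit)
  then show "choi_tp (choi \<E>)"
    by (simp add: choi_tp_def choi_nth trace_def sum_divide_distrib[symmetric])
next
  assume J: "choi_tp (choi \<E>)"
  have m: "trace (\<E> (munit i j)) = (if i = j then 1 else 0)" for i j
    using J by (auto simp: choi_tp_def choi_nth trace_def sum_divide_distrib[symmetric] split: if_splits)
  show "\<forall>X. trace (\<E> X) = trace X"
  proof
    fix X
    have "trace (\<E> X) = (\<Sum>i\<in>UNIV. \<Sum>j\<in>UNIV. X $ i $ j * trace (\<E> (munit i j)))"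
      unfolding trace_def linear_superop_nth[OF assms, of X] sum_distrib_left
      by (rule trans[OF sum.swap]) (intro sum.cong refl sum.swap)
    then show "trace (\<E> X) = trace X"
      unfolding m by (simp add: trace_def if_distrib[of "(*) _"] cong: if_cong)
  qed
qed

lemma choi_unital_iff:
  assumes "linear_superop \<E>"
  shows "choi_unital (choi \<E>) \<longleftrightarrow> \<E> (mat 1) = mat 1"
proof -
  have "\<E> (mat 1) $ a $ b = (\<Sum>i\<in>UNIV. \<E> (munit i i) $ a $ b)" for a b
    by (subst linear_superop_nth[OF assms])
      (simp add: mat_nth if_distrib[of "\<lambda>z. z * _"] cong: if_cong)
  then show ?thesis
    by (auto simp: choi_unital_def choi_nth vec_eq_iff mat_nth sum_divide_distrib[symmetric]
        split: if_splits)
qed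

lemma cinner_pair:
  fixes J :: "complex^('n::finite \<times> 'n)^('n \<times> 'n)"
  shows "cinner v (J *v v) = (\<Sum>i\<in>UNIV. \<Sum>j\<in>UNIV. \<Sum>a\<in>UNIV. \<Sum>b\<in>UNIV.
      cnj (v $ (a, i)) * (J $ (a, i) $ (b, j) * v $ (b, j)))"
proof -
  have "cinner v (J *v v) = (\<Sum>a\<in>UNIV. \<Sum>i\<in>UNIV. \<Sum>b\<in>UNIV. \<Sum>j\<in>UNIV.
      cnj (v $ (a, i)) * (J $ (a, i) $ (b, j) * v $ (b, j)))"
    by (simp add: cinner_def matrix_vector_mult_nth sum_pair_UNIV sum_distrib_left)
  also have "\<dots> = (\<Sum>i\<in>UNIV. \<Sum>a\<in>UNIV. \<Sum>b\<in>UNIV. \<Sum>j\<in>UNIV.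
      cnj (v $ (a, i)) * (J $ (a, i) $ (b, j) * v $ (b, j)))"
    by (rule sum.swap)
  also have "\<dots> = (\<Sum>i\<in>UNIV. \<Sum>a\<in>UNIV. \<Sum>j\<in>UNIV. \<Sum>b\<in>UNIV.
      cnj (v $ (a, i)) * (J $ (a, i) $ (b, j) * v $ (b, j)))"
    by (intro sum.cong refl sum.swap)
  also have "\<dots> = (\<Sum>i\<in>UNIV. \<Sum>j\<in>UNIV. \<Sum>a\<in>UNIV. \<Sum>b\<in>UNIV.
      cnj (v $ (a, i)) * (J $ (a, i) $ (b, j) * v $ (b, j)))"
    by (intro sum.cong refl sum.swap)
  finally show ?thesis .
qed

lemma cinner_ketbra: "cinner v (ketbra x y *v w) = cinner v x * cinner y w"
  by (simp add: cinner_def matrix_vector_mult_nth sum_product sum_distrib_left mult_ac)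
    (rule sum.swap)

text \<open>The matrix units, arranged as blocks, form the unnormalized projector onto the maximally
  entangled vector; applying the map to the blocks gives a multiple of the Choi matrix.\<close>

lemma completely_positive_imp_psd_choi:
  fixes \<E> :: "'n::finite superop"
  assumes "completely_positive \<E>"
  shows "psd (choi \<E>)"
  unfolding psd_def
proof
  fix v :: "complex^('n \<times> 'n)"
  let ?d = "CARD('n)"
  \<comment> \<open>Blocks are numbered by naturals, so the basis has to be enumerated.\<close>
  obtain g :: "nat \<Rightarrow> 'n" where g: "bij_betw g {..<?d} UNIV"
    using ex_bij_betw_nat_finite[of "UNIV :: 'n set"] by (auto simp: atLeast0LessThan)
  have "block_psd ?d (\<lambda>i j. munit (g i) (g j))"
    unfolding block_psd_def
  proof
    fix w :: "nat \<Rightarrow> complex^'n"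
    define s where "s = (\<Sum>i<?d. cinner (axis (g i) 1) (w i))"
    have "(\<Sum>i<?d. \<Sum>j<?d. cinner (w i) (munit (g i) (g j) *v w j)) = cnj s * s"
      unfolding cinner_ketbra s_def by (simp add: sum_product cnj_cinner del: cinner_axis_left)
    then show "0 \<le> (\<Sum>i<?d. \<Sum>j<?d. cinner (w i) (munit (g i) (g j) *v w j))"
      by (simp add: less_eq_complex_def)
  qed
  then have *: "block_psd ?d (\<lambda>i j. \<E> (munit (g i) (g j)))"
    using assms by (simp add: completely_positive_def)
  have "0 \<le> (\<Sum>i<?d. \<Sum>j<?d. cinner (\<chi> a. v $ (a, g i)) (\<E> (munit (g i) (g j)) *v (\<chi> a. v $ (a, g j))))"
    using *[unfolded block_psd_def, rule_format, of "\<lambda>i. \<chi> a. v $ (a, g i)"] by simp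
  also have "\<dots> = (\<Sum>i\<in>UNIV. \<Sum>j\<in>UNIV. cinner (\<chi> a. v $ (a, i)) (\<E> (munit i j) *v (\<chi> a. v $ (a, j))))"
    by (simp add: sum.reindex_bij_betw[OF g, where g = "\<lambda>j. cinner _ (\<E> (munit _ j) *v (\<chi> a. v $ (a, j)))"]
        sum.reindex_bij_betw[OF g, where g = "\<lambda>i. \<Sum>j\<in>UNIV. cinner (\<chi> a. v $ (a, i)) (\<E> (munit i j) *v (\<chi> a. v $ (a, j)))"])
  also have "\<dots> = of_nat ?d * cinner v (choi \<E> *v v)"
    unfolding cinner_pair choi_nth
    by (simp add: cinner_def matrix_vector_mult_nth sum_distrib_left sum_divide_distrib)
  finally show "0 \<le> cinner v (choi \<E> *v v)"
    by (simp add: less_eq_complex_def zero_le_mult_iff)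
qed

text \<open>Eigenvectors of \<open>J\<close>, reshaped into matrices \<open>K m\<close>, are Kraus
  operators, with weights \<open>CARD('n)\<close> times the eigenvalues.\<close>

lemma completely_positive_unchoi:
  fixes J :: "complex^('n::finite \<times> 'n)^('n \<times> 'n)"
  assumes "psd J"
  shows "completely_positive (unchoi J)"
  unfolding completely_positive_def
proof (intro allI impI)
  fix k :: nat and X :: "nat \<Rightarrow> nat \<Rightarrow> complex^'n^'n"
  assume X: "block_psd k X"
  obtain U s where Us: "diagonalizes U s J" "\<And>i. 0 \<le> s i"
    using psd_diagonalizable[OF assms] by blast
  define K :: "'n \<times> 'n \<Rightarrow> complex^'n^'n" where "K m = (\<chi> a i. U $ (a, i) $ m)" for m
  have J: "J $ x $ y = (\<Sum>m\<in>UNIV. U $ x $ m * of_real (s m) * cnj (U $ y $ m))" for x y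
    using Us(1) by (simp add: diagonalizes_def matrix_mult_nth[of "U ** real_diag s"]
        matrix_mult_real_diag_nth)
  have kraus: "unchoi J Y = (\<Sum>m\<in>UNIV. (real CARD('n) * s m) *\<^sub>R (K m ** Y ** mdagger (K m)))" for Y
  proof -
    have "unchoi J Y $ a $ b = (\<Sum>m\<in>UNIV. (real CARD('n) * s m) *\<^sub>R (K m ** Y ** mdagger (K m))) $ a $ b" for a b
    proof -
      have "unchoi J Y $ a $ b = (\<Sum>i\<in>UNIV. \<Sum>j\<in>UNIV. \<Sum>m\<in>UNIV.
          of_real (real CARD('n) * s m) * (U $ (a, i) $ m * Y $ i $ j * cnj (U $ (b, j) $ m)))"
        by (simp add: unchoi_def J sum_distrib_left mult_ac)
      also have "\<dots> = (\<Sum>i\<in>UNIV. \<Sum>m\<in>UNIV. \<Sum>j\<in>UNIV.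
          of_real (real CARD('n) * s m) * (U $ (a, i) $ m * Y $ i $ j * cnj (U $ (b, j) $ m)))"
        by (intro sum.cong refl sum.swap)
      also have "\<dots> = (\<Sum>m\<in>UNIV. \<Sum>i\<in>UNIV. \<Sum>j\<in>UNIV.
          of_real (real CARD('n) * s m) * (U $ (a, i) $ m * Y $ i $ j * cnj (U $ (b, j) $ m)))"
        by (rule sum.swap)
      also have "\<dots> = (\<Sum>m\<in>UNIV. \<Sum>j\<in>UNIV. \<Sum>i\<in>UNIV.
          of_real (real CARD('n) * s m) * (U $ (a, i) $ m * Y $ i $ j * cnj (U $ (b, j) $ m)))"
        by (intro sum.cong refl sum.swap)
      also have "\<dots> = (\<Sum>m\<in>UNIV. (real CARD('n) * s m) *\<^sub>R (K m ** Y ** mdagger (K m))) $ a $ b"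
        by (simp add: matrix_mult_nth K_def sum_distrib_left sum_distrib_right
            scaleR_conv_of_real[where 'a = complex])
      finally show ?thesis .
    qed
    then show ?thesis by (simp add: vec_eq_iff)
  qed
  show "block_psd k (\<lambda>i j. unchoi J (X i j))"
    unfolding block_psd_def
  proof
    fix v :: "nat \<Rightarrow> complex^'n"
    have "cinner (v i) (unchoi J (X i j) *v v j) = (\<Sum>m\<in>UNIV. of_real (real CARD('n) * s m) *
        cinner (mdagger (K m) *v v i) (X i j *v (mdagger (K m) *v v j)))" for i j
    proof -
      have sum: "sum f S *v w = (\<Sum>m\<in>S. f m *v w)" for f :: "'n \<times> 'n \<Rightarrow> complex^'n^'n" and S w
        by (induction S rule: infinite_finite_induct) (simp_all add: matrix_vector_mult_add_rdistrib)
      have sum': "cinner x (sum f S) = (\<Sum>m\<in>S. cinner x (f m))" for f :: "'n \<times> 'n \<Rightarrow> complex^'n" and S x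
        by (induction S rule: infinite_finite_induct) (simp_all add: cinner_add_right)
      show ?thesis
        unfolding kraus sum sum'
        by (simp add: matrix_vector_mult_scaleR cinner_scaleR_right cinner_mult_left
            matrix_vector_mul_assoc matrix_mul_assoc)
    qed
    then have "(\<Sum>i<k. \<Sum>j<k. cinner (v i) (unchoi J (X i j) *v v j)) =
        (\<Sum>i<k. \<Sum>j<k. \<Sum>m\<in>UNIV. of_real (real CARD('n) * s m) *
        cinner (mdagger (K m) *v v i) (X i j *v (mdagger (K m) *v v j)))" by simp
    also have "\<dots> = (\<Sum>i<k. \<Sum>m\<in>UNIV. \<Sum>j<k. of_real (real CARD('n) * s m) *
        cinner (mdagger (K m) *v v i) (X i j *v (mdagger (K m) *v v j)))"
      by (intro sum.cong refl sum.swap)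
    also have "\<dots> = (\<Sum>m\<in>UNIV. \<Sum>i<k. \<Sum>j<k. of_real (real CARD('n) * s m) *
        cinner (mdagger (K m) *v v i) (X i j *v (mdagger (K m) *v v j)))"
      by (rule sum.swap)
    also have "\<dots> = (\<Sum>m\<in>UNIV. of_real (real CARD('n) * s m) * (\<Sum>i<k. \<Sum>j<k.
        cinner (mdagger (K m) *v v i) (X i j *v (mdagger (K m) *v v j))))"
      by (simp add: sum_distrib_left)
    also have "0 \<le> \<dots>"
    proof (rule sum_nonneg, rule mult_nonneg_nonneg)
      fix m
      show "0 \<le> complex_of_real (real CARD('n) * s m)"
        using Us(2)[of m] by (simp only: complex_of_real_nonneg_iff) simp
      show "0 \<le> (\<Sum>i<k. \<Sum>j<k. cinner (mdagger (K m) *v v i) (X i j *v (mdagger (K m) *v v j)))"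
        using X[unfolded block_psd_def, rule_format, of "\<lambda>i. mdagger (K m) *v v i"] by simp
    qed
    finally show "0 \<le> (\<Sum>i<k. \<Sum>j<k. cinner (v i) (unchoi J (X i j) *v v j))" .
  qed
qed

section \<open>Channels as constraints on Choi matrices\<close>

lemma channel_iff_choi:
  "channel \<E> \<longleftrightarrow> linear_superop \<E> \<and> psd (choi \<E>) \<and> choi_tp (choi \<E>)"
  unfolding channel_def
  by (metis choi_tp_iff completely_positive_imp_psd_choi completely_positive_unchoi unchoi_choi)

definition unital_choi :: "(complex^('n::finite \<times> 'n)^('n \<times> 'n)) set" where
  "unital_choi = {J. choi_tp J \<and> choi_unital J}"

lemma Unital_iff_choi:
  "\<E> \<in> Unital \<longleftrightarrow> linear_superop \<E> \<and> psd (choi \<E>) \<and> choi \<E> \<in> unital_choi"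
  by (auto simp: Unital_def channel_iff_choi unital_choi_def choi_unital_iff)

lemma trace_choi_tp:
  assumes "choi_tp J"
  shows "trace J = 1"
proof -
  have "trace J = (\<Sum>i\<in>UNIV. \<Sum>a\<in>UNIV. J $ (a, i) $ (a, i))"
    unfolding trace_def sum_pair_UNIV by (rule sum.swap)
  with assms show ?thesis by (simp add: choi_tp_def)
qed

lemma affine_unital_choi: "affine unital_choi"
  unfolding affine_def
proof (intro ballI allI impI)
  fix J J' :: "complex^('a::finite \<times> 'a)^('a \<times> 'a)" and u v :: real
  assume J: "J \<in> unital_choi" "J' \<in> unital_choi" and uv: "u + v = 1"
  have c: "u *\<^sub>R c + v *\<^sub>R c = c" for c :: complex
    by (simp add: uv flip: scaleR_add_left)
  show "u *\<^sub>R J + v *\<^sub>R J' \<in> unital_choi"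
    using J by (simp add: unital_choi_def choi_tp_def choi_unital_def sum.distrib c
        flip: scaleR_right.sum)
qed

text \<open>The completely depolarizing channel: it shows that the feasible sets are nonempty and is
  the point that a singular candidate is mixed with.\<close>

lemma maximally_mixed_unital_choi:
  "(1 / CARD('n \<times> 'n)) *\<^sub>R mat 1 \<in> (unital_choi :: (complex^('n::finite \<times> 'n)^('n \<times> 'n)) set)"
proof -
  have "(\<Sum>a\<in>(UNIV :: 'n set). ((1 / CARD('n \<times> 'n)) *\<^sub>R mat 1 :: complex^('n \<times> 'n)^('n \<times> 'n)) $ (a, i) $ (a, j))
      = (if i = j then 1 / of_nat CARD('n) else 0)"
    "(\<Sum>a\<in>(UNIV :: 'n set). ((1 / CARD('n \<times> 'n)) *\<^sub>R mat 1 :: complex^('n \<times> 'n)^('n \<times> 'n)) $ (i, a) $ (j, a))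
      = (if i = j then 1 / of_nat CARD('n) else 0)" for i j
    by (cases "i = j"; simp add: mat_nth scaleR_conv_of_real[where 'a = complex])+
  then show ?thesis unfolding unital_choi_def choi_tp_def choi_unital_def by blast
qed

subsection \<open>Motion reversal\<close>

definition vconj :: "complex^'n \<Rightarrow> complex^'n" where
  "vconj v = (\<chi> i. cnj (v $ i))"

definition mconj :: "complex^'n^'m \<Rightarrow> complex^'n^'m" where
  "mconj A = (\<chi> i j. cnj (A $ i $ j))"

lemma vconj_nth [simp]: "vconj v $ i = cnj (v $ i)"
  by (simp add: vconj_def)

lemma mconj_nth [simp]: "mconj A $ i $ j = cnj (A $ i $ j)"
  by (simp add: mconj_def)

lemma mconj_mconj [simp]: "mconj (mconj A) = A"
  by (simp add: vec_eq_iff)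

lemma vconj_vconj [simp]: "vconj (vconj v) = v"
  by (simp add: vec_eq_iff)

lemma mconj_mult: "mconj (A ** B) = mconj A ** mconj B"
  by (simp add: vec_eq_iff matrix_mult_nth)

lemma vconj_mult: "vconj (A *v v) = mconj A *v vconj v"
  by (simp add: vec_eq_iff matrix_vector_mult_nth)

lemma transpose_nth: "transpose A $ i $ j = A $ j $ i"
  by (simp add: transpose_def)

lemma mconj_transpose: "mconj (transpose A) = mdagger A"
  by (simp add: vec_eq_iff transpose_nth)

lemma mdagger_transpose: "mdagger (transpose A) = mconj A"
  by (simp add: vec_eq_iff transpose_nth)

text \<open>The columns of \<open>U\<close> are the images of the basis vectors; antilinearity
  extends this to all vectors, and the condition on inner products makes the columns
  orthonormal.\<close>

lemma antiunitary_imp_matrix: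
  fixes \<Theta> :: "complex^'n \<Rightarrow> complex^'n"
  assumes "antiunitary \<Theta>"
  obtains U where "unitary_matrix U" "\<Theta> = (\<lambda>v. U *v vconj v)"
proof -
  define U :: "complex^'n^'n" where "U = (\<chi> i j. \<Theta> (axis j 1) $ i)"
  have add: "\<Theta> (x + y) = \<Theta> x + \<Theta> y" and scale: "\<Theta> (c *s x) = cnj c *s \<Theta> x"
    and inner: "cinner (\<Theta> x) (\<Theta> y) = cnj (cinner x y)" for x y c
    using assms by (auto simp: antiunitary_def antilinear_def)
  have "\<Theta> 0 = 0" using scale[of 0 0] by simp
  then have sum: "\<Theta> (sum f S) = (\<Sum>s\<in>S. \<Theta> (f s))" for f :: "'n \<Rightarrow> complex^'n" and S
    by (induction S rule: infinite_finite_induct) (simp_all add: add)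
  have "\<Theta> v = U *v vconj v" for v
  proof -
    have "v = (\<Sum>j\<in>UNIV. v $ j *s axis j 1)" by (simp add: basis_expansion)
    then have "\<Theta> v = \<Theta> (\<Sum>j\<in>UNIV. v $ j *s axis j 1)" by (rule arg_cong)
    also have "\<dots> = (\<Sum>j\<in>UNIV. cnj (v $ j) *s \<Theta> (axis j 1))" by (simp add: sum scale)
    also have "\<dots> = U *v vconj v"
      by (simp add: vec_eq_iff matrix_vector_mult_nth U_def mult.commute)
    finally show ?thesis .
  qed
  moreover have "unitary_matrix U"
  proof -
    have "(mdagger U ** U) $ i $ j = cinner (\<Theta> (axis i 1)) (\<Theta> (axis j 1))" for i j
      by (simp add: matrix_mult_nth U_def cinner_def)
    then have "mdagger U ** U = mat 1"
      unfolding inner by (simp add: vec_eq_iff mat_nth) (simp add: axis_def)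
    then show ?thesis by (simp add: unitary_matrix_def matrix_left_right_inverse)
  qed
  ultimately show ?thesis using that by blast
qed

lemma anti_adjoint_matrix: "anti_adjoint (\<lambda>v. U *v vconj v) = (\<lambda>v. transpose U *v vconj v)"
  unfolding anti_adjoint_def
proof (rule the_equality)
  have "cinner \<psi> (transpose U *v vconj \<phi>) = cinner \<phi> (U *v vconj \<psi>)" for \<psi> \<phi>
    by (simp add: cinner_def matrix_vector_mult_nth transpose_nth sum_distrib_left mult_ac del: transpose_matrix_vector)
      (rule sum.swap)
  then show "\<forall>\<psi> \<phi>. cinner \<psi> (transpose U *v vconj \<phi>) = cinner \<phi> (U *v vconj \<psi>)" by blast
  fix T assume T: "\<forall>\<psi> \<phi>. cinner \<psi> (T \<phi>) = cinner \<phi> (U *v vconj \<psi>)"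
  have "T \<phi> $ i = (transpose U *v vconj \<phi>) $ i" for \<phi> i
    using T[rule_format, of "axis i 1" \<phi>] \<open>\<And>\<psi> \<phi>. cinner \<psi> (transpose U *v vconj \<phi>) = cinner \<phi> (U *v vconj \<psi>)\<close>[of "axis i 1" \<phi>]
    by simp
  then show "T = (\<lambda>v. transpose U *v vconj v)" by (simp add: fun_eq_iff vec_eq_iff)
qed

lemma Ad_matrix: "Ad (\<lambda>v. U *v vconj v) \<rho> = U ** mconj \<rho> ** mdagger U"
proof -
  have "U *v vconj (\<rho> *v (transpose U *v vconj v)) = (U ** mconj \<rho> ** mdagger U) *v v" for v
    by (simp add: vconj_mult mconj_mult mconj_transpose matrix_vector_mul_assoc matrix_mul_assoc
        del: transpose_matrix_vector)
  then show ?thesis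
    unfolding Ad_def anti_adjoint_matrix by simp
qed

lemma trace_mdagger_mult: "trace (mdagger A ** B) = (\<Sum>i\<in>UNIV. \<Sum>j\<in>UNIV. cnj (A $ i $ j) * B $ i $ j)"
  unfolding trace_def matrix_mult_nth mdagger_nth by (rule sum.swap)

text \<open>Testing an adjoint against the matrix units recovers each of its entries, which gives
  both the formula and the uniqueness required by \<open>THE\<close>.\<close>

lemma hs_adjoint_matrix:
  assumes "linear_superop \<E>"
  shows "hs_adjoint \<E> X = (\<chi> p q. cnj (trace (mdagger X ** \<E> (munit p q))))"
proof -
  define F where "F X = (\<chi> p q. cnj (trace (mdagger X ** \<E> (munit p q))))" for X
  have F: "trace (mdagger (F X) ** Y) = trace (mdagger X ** \<E> Y)" for X Y
  proof -
    let ?f = "\<lambda>p q a b. cnj (X $ a $ b) * (Y $ p $ q * \<E> (munit p q) $ a $ b)"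
    have "trace (mdagger (F X) ** Y) = (\<Sum>p\<in>UNIV. \<Sum>q\<in>UNIV. \<Sum>a\<in>UNIV. \<Sum>b\<in>UNIV. ?f p q a b)"
      unfolding trace_mdagger_mult by (simp add: F_def trace_mdagger_mult sum_distrib_left mult_ac)
    also have "\<dots> = (\<Sum>p\<in>UNIV. \<Sum>a\<in>UNIV. \<Sum>q\<in>UNIV. \<Sum>b\<in>UNIV. ?f p q a b)"
      by (intro sum.cong refl sum.swap)
    also have "\<dots> = (\<Sum>p\<in>UNIV. \<Sum>a\<in>UNIV. \<Sum>b\<in>UNIV. \<Sum>q\<in>UNIV. ?f p q a b)"
      by (intro sum.cong refl sum.swap)
    also have "\<dots> = (\<Sum>a\<in>UNIV. \<Sum>p\<in>UNIV. \<Sum>b\<in>UNIV. \<Sum>q\<in>UNIV. ?f p q a b)"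
      by (rule sum.swap)
    also have "\<dots> = (\<Sum>a\<in>UNIV. \<Sum>b\<in>UNIV. \<Sum>p\<in>UNIV. \<Sum>q\<in>UNIV. ?f p q a b)"
      by (intro sum.cong refl sum.swap)
    also have "\<dots> = trace (mdagger X ** \<E> Y)"
      unfolding trace_mdagger_mult linear_superop_nth[OF assms, of Y] by (simp add: sum_distrib_left)
    finally show ?thesis .
  qed
  have "hs_adjoint \<E> = F"
    unfolding hs_adjoint_def
  proof (rule the_equality)
    show "\<forall>X Y. trace (mdagger (F X) ** Y) = trace (mdagger X ** \<E> Y)" using F by blast
    fix G assume G: "\<forall>X Y. trace (mdagger (G X) ** Y) = trace (mdagger X ** \<E> Y)"
    show "G = F"
    proof
      fix X
      have "trace (mdagger A ** munit p q) = cnj (A $ p $ q)" for A :: "complex^'a^'a" and p q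
      proof -
        have "trace (mdagger A ** munit p q)
            = (\<Sum>i\<in>UNIV. \<Sum>j\<in>UNIV. if j = q then if i = p then cnj (A $ i $ j) else 0 else 0)"
          unfolding trace_mdagger_mult munit_nth by (intro sum.cong refl) auto
        then show ?thesis by simp
      qed
      then have "cnj (G X $ p $ q) = cnj (F X $ p $ q)" for p q
        using F G by metis
      then show "G X = F X" by (simp add: vec_eq_iff)
    qed
  qed
  then show ?thesis by (simp add: F_def)
qed

lemma motion_reversed_matrix:
  assumes "\<Theta> = (\<lambda>v. U *v vconj v)"
  shows "motion_reversed \<Theta> \<E> X
    = transpose U ** mconj (hs_adjoint \<E> (U ** mconj X ** mdagger U)) ** mconj U"
  unfolding motion_reversed_def assms anti_adjoint_matrix o_apply Ad_matrix mdagger_transpose ..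

text \<open>Each of the two \<open>Ad\<close> maps is antilinear on operators, so their complex
  conjugations of scalars cancel.\<close>

lemma linear_motion_reversed:
  assumes "\<Theta> = (\<lambda>v. U *v vconj v)" "linear_superop \<E>"
  shows "linear_superop (motion_reversed \<Theta> \<E>)"
proof -
  have scale: "cscale c A ** B = cscale c (A ** B)" "A ** cscale c B = cscale c (A ** B)" for c and A B :: "complex^'a^'a"
    by (simp_all add: vec_eq_iff matrix_mult_nth sum_distrib_left mult_ac)
  have mconj: "mconj (A + B) = mconj A + mconj B" "mconj (cscale c A) = cscale (cnj c) (mconj A)" for c and A B :: "complex^'a^'a"
    by (simp_all add: vec_eq_iff)
  have md: "mdagger (cscale c A) = cscale (cnj c) (mdagger A)" for c and A :: "complex^'a^'a"
    by (simp add: vec_eq_iff)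
  have tr: "trace (cscale c A) = c * trace A" for c and A :: "complex^'a^'a"
    by (simp add: trace_def sum_distrib_left)
  have hs: "hs_adjoint \<E> (A + B) = hs_adjoint \<E> A + hs_adjoint \<E> B"
    "hs_adjoint \<E> (cscale c A) = cscale c (hs_adjoint \<E> A)" for c A B
    unfolding hs_adjoint_matrix[OF assms(2)]
    by (simp_all add: vec_eq_iff mdagger_add matrix_mult_add_left trace_add md scale tr)
  show ?thesis
    unfolding linear_superop_def motion_reversed_matrix[OF assms(1)]
    by (simp add: mconj hs matrix_add_ldistrib matrix_mult_add_left scale)
qed

text \<open>With \<open>\<Theta> = U K\<close>, \<open>K\<close> the complex conjugation, \<open>\<E> \<mapsto> \<E>\<^sub>\<Theta>\<close> sends a Kraus operator \<open>A\<close> to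
  \<open>U\<^sup>T A\<^sup>T U\<^sup>*\<close>; \<open>reversal U\<close> is this map on the vectorized operators.\<close>

definition reversal :: "complex^'n^'n \<Rightarrow> complex^('n::finite \<times> 'n)^('n \<times> 'n)" where
  "reversal U = (\<chi> x y. U $ snd y $ fst x * cnj (U $ fst y $ snd x))"

lemma reversal_nth: "reversal U $ (a, i) $ (p, q) = U $ q $ a * cnj (U $ p $ i)"
  by (simp add: reversal_def)

lemma sum_swap4:
  "(\<Sum>a\<in>A. \<Sum>b\<in>B. \<Sum>c\<in>C. \<Sum>d\<in>D. f a b c d) = (\<Sum>d\<in>D. \<Sum>a\<in>A. \<Sum>c\<in>C. \<Sum>b\<in>B. f a b c d)"
proof -
  have "(\<Sum>b\<in>B. \<Sum>c\<in>C. \<Sum>d\<in>D. f a b c d) = (\<Sum>d\<in>D. \<Sum>c\<in>C. \<Sum>b\<in>B. f a b c d)" for a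
  proof -
    have "(\<Sum>b\<in>B. \<Sum>c\<in>C. \<Sum>d\<in>D. f a b c d) = (\<Sum>c\<in>C. \<Sum>b\<in>B. \<Sum>d\<in>D. f a b c d)" by (rule sum.swap)
    also have "\<dots> = (\<Sum>c\<in>C. \<Sum>d\<in>D. \<Sum>b\<in>B. f a b c d)" by (intro sum.cong refl sum.swap)
    also have "\<dots> = (\<Sum>d\<in>D. \<Sum>c\<in>C. \<Sum>b\<in>B. f a b c d)" by (rule sum.swap)
    finally show ?thesis .
  qed
  then have "(\<Sum>a\<in>A. \<Sum>b\<in>B. \<Sum>c\<in>C. \<Sum>d\<in>D. f a b c d) = (\<Sum>a\<in>A. \<Sum>d\<in>D. \<Sum>c\<in>C. \<Sum>b\<in>B. f a b c d)"
    by simp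
  also have "\<dots> = (\<Sum>d\<in>D. \<Sum>a\<in>A. \<Sum>c\<in>C. \<Sum>b\<in>B. f a b c d)" by (rule sum.swap)
  finally show ?thesis .
qed

text \<open>The comparison is entrywise rather than through Kraus operators, so it covers all linear
  maps, including \<open>unchoi J\<close> for a \<open>J\<close> without any positivity.\<close>

lemma choi_motion_reversed:
  fixes \<E> :: "'n::finite superop"
  assumes \<Theta>: "\<Theta> = (\<lambda>v. U *v vconj v)" and lin: "linear_superop \<E>"
  shows "choi (motion_reversed \<Theta> \<E>) = reversal U ** choi \<E> ** mdagger (reversal U)"
proof -
  have "choi (motion_reversed \<Theta> \<E>) $ (a, i) $ (b, j)
      = (reversal U ** choi \<E> ** mdagger (reversal U)) $ (a, i) $ (b, j)" for a i b j
  proof -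
    define M where "M = U ** mconj (munit i j) ** mdagger U"
    let ?f = "\<lambda>q' q p p'. U $ q $ a * cnj (U $ p $ i) * (choi \<E> $ (p, q) $ (p', q'))
        * (cnj (U $ q' $ b) * U $ p' $ j)"
    \<comment> \<open>\<open>Ad \<Theta>\<close> sends the matrix unit to the ketbra of columns
      \<open>i\<close> and \<open>j\<close> of \<open>U\<close>.\<close>
    have M: "cnj (M $ p $ p') = cnj (U $ p $ i) * U $ p' $ j" for p p'
    proof -
      have "M $ p $ p' = (\<Sum>k\<in>UNIV. \<Sum>l\<in>UNIV. if l = i then if k = j then U $ p $ l * cnj (U $ p' $ k) else 0 else 0)"
        unfolding M_def matrix_mult_nth mconj_nth munit_nth mdagger_nth sum_distrib_right
        by (intro sum.cong refl) auto
      also have "\<dots> = U $ p $ i * cnj (U $ p' $ j)" by simp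
      finally show ?thesis by simp
    qed
    have "motion_reversed \<Theta> \<E> (munit i j) $ a $ b
        = (\<Sum>q'\<in>UNIV. \<Sum>q\<in>UNIV. \<Sum>p\<in>UNIV. \<Sum>p'\<in>UNIV. U $ q $ a * (cnj (U $ p $ i) * U $ p' $ j * \<E> (munit q q') $ p $ p')
            * cnj (U $ q' $ b))"
      unfolding motion_reversed_matrix[OF \<Theta>] M_def[symmetric]
      by (simp add: matrix_mult_nth transpose_nth hs_adjoint_matrix[OF lin] trace_mdagger_mult M
          sum_distrib_left sum_distrib_right)
    then have "choi (motion_reversed \<Theta> \<E>) $ (a, i) $ (b, j)
        = (\<Sum>q'\<in>UNIV. \<Sum>q\<in>UNIV. \<Sum>p\<in>UNIV. \<Sum>p'\<in>UNIV. ?f q' q p p')"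
      by (simp add: choi_nth sum_divide_distrib mult_ac)
    also have "\<dots> = (\<Sum>p'\<in>UNIV. \<Sum>q'\<in>UNIV. \<Sum>p\<in>UNIV. \<Sum>q\<in>UNIV. ?f q' q p p')"
      by (rule sum_swap4)
    also have "\<dots> = (reversal U ** choi \<E> ** mdagger (reversal U)) $ (a, i) $ (b, j)"
      by (simp add: matrix_mult_nth[of "reversal U ** choi \<E>"] matrix_mult_nth[of "reversal U"]
          sum_pair_UNIV reversal_nth sum_distrib_right)
    finally show ?thesis .
  qed
  then show ?thesis by (simp add: vec_eq_iff)
qed

text \<open>Trace preservation says precisely that the adjoint map fixes the identity, and both
  conjugations fix it too.\<close>

lemma motion_reversed_unital:
  assumes \<Theta>: "\<Theta> = (\<lambda>v. U *v vconj v)" and U: "unitary_matrix U" and lin: "linear_superop \<E>"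
    and tp: "\<And>X. trace (\<E> X) = trace X"
  shows "motion_reversed \<Theta> \<E> (mat 1) = mat 1"
proof -
  have 1: "mconj (mat 1) = mat 1" by (simp add: vec_eq_iff mat_nth)
  have "hs_adjoint \<E> (mat 1) = mat 1"
    unfolding hs_adjoint_matrix[OF lin] by (simp add: tp trace_munit vec_eq_iff mat_nth)
  moreover have "mconj (mdagger U ** U) = mat 1" by (simp add: unitary_matrixD[OF U] 1)
  then have "transpose U ** mconj U = mat 1"
    by (simp add: mconj_mult) (simp add: vec_eq_iff matrix_mult_nth transpose_nth)
  ultimately show ?thesis
    unfolding motion_reversed_matrix[OF \<Theta>] by (simp add: 1 unitary_matrixD[OF U])
qed

text \<open>Dual to \<open>motion_reversed_unital\<close>. The two complex conjugations of the trace
  cancel.\<close>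

lemma trace_motion_reversed:
  fixes \<E> :: "'n::finite superop"
  assumes \<Theta>: "\<Theta> = (\<lambda>v. U *v vconj v)" and U: "unitary_matrix U" and lin: "linear_superop \<E>"
    and unital: "\<E> (mat 1) = mat 1"
  shows "trace (motion_reversed \<Theta> \<E> X) = trace X"
proof -
  have trc: "trace (mconj A) = cnj (trace A)" for A :: "complex^'n^'n" by (simp add: trace_def)
  have tru: "trace (V ** A ** W) = trace A" if "W ** V = mat 1" for V A W :: "complex^'n^'n"
    using that by (metis matrix_mul_assoc matrix_mul_lid trace_mul_sym)
  have hs: "trace (hs_adjoint \<E> A) = trace A" for A
  proof -
    have "(\<Sum>q\<in>UNIV. trace (mdagger A ** \<E> (munit q q))) = trace (mdagger A ** \<E> (\<Sum>q\<in>UNIV. munit q q))"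
    proof -
      have "trace (mdagger A ** sum f S) = (\<Sum>q\<in>S. trace (mdagger A ** f q))" for f :: "'n \<Rightarrow> complex^'n^'n" and S
        by (induction S rule: infinite_finite_induct) (simp_all add: matrix_add_ldistrib trace_add trace_0[unfolded mat_0])
      then show ?thesis by (simp add: linear_superop_sum[OF lin])
    qed
    also have "(\<Sum>q\<in>(UNIV :: 'n set). munit q q) = mat 1"
    proof -
      have "(\<Sum>q\<in>UNIV. munit q q) $ a $ b = mat 1 $ a $ b" for a b :: 'n
      proof -
        have "(\<Sum>q\<in>UNIV. munit q q) $ a $ b = (\<Sum>q\<in>UNIV. if q = a then if a = b then 1 else 0 else 0)"
          unfolding sum_component munit_nth by (intro sum.cong refl) auto
        then show ?thesis by (simp add: mat_nth)
      qed
      then show ?thesis by (rule matrix_eqI)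
    qed
    finally have "(\<Sum>q\<in>UNIV. trace (mdagger A ** \<E> (munit q q))) = cnj (trace A)"
      by (simp add: unital trace_mdagger)
    then have "cnj (\<Sum>q\<in>UNIV. trace (mdagger A ** \<E> (munit q q))) = trace A" by simp
    then show ?thesis by (simp add: hs_adjoint_matrix[OF lin] trace_def[of "vec_lambda _"])
  qed
  have 1: "mconj (mat 1) = mat 1" by (simp add: vec_eq_iff mat_nth)
  have "mconj (U ** mdagger U) = mat 1" by (simp add: unitary_matrixD[OF U] 1)
  then have UU: "mconj U ** transpose U = mat 1"
    by (simp add: mconj_mult) (simp add: vec_eq_iff matrix_mult_nth transpose_nth)
  show ?thesis
    unfolding motion_reversed_matrix[OF \<Theta>]
    by (simp add: tru[OF UU] trc hs tru[OF unitary_matrixD(1)[OF U]])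
qed

text \<open>Motion reversal exchanges the two marginal conditions. Hence it preserves
  \<open>unital_choi\<close>, and a trace-preserving fixed point is automatically unital.\<close>

lemma reversal_unital_choi:
  fixes J :: "complex^('n::finite \<times> 'n)^('n \<times> 'n)"
  assumes U: "unitary_matrix U"
  shows "choi_tp J \<Longrightarrow> choi_unital (reversal U ** J ** mdagger (reversal U))"
    and "choi_unital J \<Longrightarrow> choi_tp (reversal U ** J ** mdagger (reversal U))"
proof -
  define \<Theta> where "\<Theta> = (\<lambda>v. U *v vconj v)"
  note lin = linear_unchoi[of J]
  note lin' = linear_motion_reversed[OF \<Theta>_def lin]
  have eq: "choi (motion_reversed \<Theta> (unchoi J)) = reversal U ** J ** mdagger (reversal U)"
    using choi_motion_reversed[OF \<Theta>_def lin] by (simp add: choi_unchoi)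
  show "choi_unital (reversal U ** J ** mdagger (reversal U))" if "choi_tp J"
    unfolding eq[symmetric] choi_unital_iff[OF lin']
    using that choi_tp_iff[OF lin] by (intro motion_reversed_unital[OF \<Theta>_def U lin]) (simp add: choi_unchoi)
  show "choi_tp (reversal U ** J ** mdagger (reversal U))" if "choi_unital J"
    unfolding eq[symmetric] choi_tp_iff[OF lin']
    using that choi_unital_iff[OF lin] by (intro allI trace_motion_reversed[OF \<Theta>_def U lin]) (simp add: choi_unchoi)
qed

lemma TRS_iff_choi:
  assumes \<Theta>: "\<Theta> = (\<lambda>v. U *v vconj v)" and U: "unitary_matrix U"
  shows "\<E> \<in> TRS \<Theta> \<longleftrightarrow> linear_superop \<E> \<and> psd (choi \<E>) \<and> choi \<E> \<in> unital_choi \<and>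
    reversal U ** choi \<E> ** mdagger (reversal U) = choi \<E>"
proof -
  have "\<E> = motion_reversed \<Theta> \<E> \<longleftrightarrow> reversal U ** choi \<E> ** mdagger (reversal U) = choi \<E>"
    if "linear_superop \<E>"
    using choi_inject[OF that linear_motion_reversed[OF \<Theta> that]] choi_motion_reversed[OF \<Theta> that]
    by metis
  then show ?thesis
    using reversal_unital_choi(1)[OF U, of "choi \<E>"]
    by (auto simp: TRS_def channel_iff_choi unital_choi_def)
qed

lemma unitary_reversal:
  fixes U :: "complex^'n::finite^'n"
  assumes U: "unitary_matrix U"
  shows "unitary_matrix (reversal U)"
proof -
  have UU: "(\<Sum>q\<in>UNIV. cnj (U $ q $ b) * U $ q $ a) = (if a = b then 1 else 0)" for a b
    using arg_cong[OF unitary_matrixD(1)[OF U], of "\<lambda>M. M $ b $ a"] by (auto simp: matrix_mult_nth mat_nth)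
  have "(reversal U ** mdagger (reversal U)) $ (a, i) $ (b, j) = mat 1 $ (a, i) $ (b, j)" for a i b j
  proof -
    have "(reversal U ** mdagger (reversal U)) $ (a, i) $ (b, j)
        = (\<Sum>p\<in>UNIV. cnj (U $ p $ i) * U $ p $ j) * (\<Sum>q\<in>UNIV. cnj (U $ q $ b) * U $ q $ a)"
      unfolding sum_product by (simp add: matrix_mult_nth sum_pair_UNIV reversal_nth mult_ac)
    then show ?thesis by (auto simp: UU mat_nth)
  qed
  then have "reversal U ** mdagger (reversal U) = mat 1" by (simp add: vec_eq_iff)
  then show ?thesis by (simp add: unitary_matrix_def matrix_left_right_inverse)
qed

text \<open>The square of \<Theta> is \<open>U ** mconj U\<close>, a phase.
  \<open>reversal U\<close> contains \<open>U\<close> once plainly and once conjugated, so its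
  square carries the phase and its conjugate, which multiply to 1.\<close>

lemma reversal_involution:
  fixes U :: "complex^'n::finite^'n"
  assumes U: "unitary_matrix U" and c: "U ** mconj U = cscale c (mat 1)" "cmod c = 1"
  shows "reversal U ** reversal U = mat 1"
proof -
  have A: "(\<Sum>p\<in>UNIV. U $ s $ p * cnj (U $ p $ i)) = (if s = i then c else 0)" for s i
    using arg_cong[OF c(1), of "\<lambda>M. M $ s $ i"] by (simp add: matrix_mult_nth mat_nth)
  have cc: "cnj c * c = 1" using c(2) by (metis complex_norm_square mult.commute of_real_1 one_power2)
  have V: "mconj U ** U = cscale (cnj c) (mat 1)"
    using arg_cong[OF c(1), of mconj] by (simp add: mconj_mult) (simp add: vec_eq_iff mat_nth)
  have B: "(\<Sum>q\<in>UNIV. cnj (U $ r $ q) * U $ q $ a) = (if r = a then cnj c else 0)" for r a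
    using arg_cong[OF V, of "\<lambda>M. M $ r $ a"] by (simp add: matrix_mult_nth mat_nth)
  have "(reversal U ** reversal U) $ (a, i) $ (r, s) = mat 1 $ (a, i) $ (r, s)" for a i r s
  proof -
    have "(reversal U ** reversal U) $ (a, i) $ (r, s)
        = (\<Sum>p\<in>UNIV. U $ s $ p * cnj (U $ p $ i)) * (\<Sum>q\<in>UNIV. cnj (U $ r $ q) * U $ q $ a)"
      unfolding sum_product by (simp add: matrix_mult_nth sum_pair_UNIV reversal_nth mult_ac)
    then show ?thesis unfolding A B using cc by (auto simp: mat_nth mult.commute)
  qed
  then show ?thesis by (simp add: vec_eq_iff)
qed

lemma motion_reversal_imp_matrix:
  fixes \<Theta> :: "complex^'n::finite \<Rightarrow> complex^'n"
  assumes "motion_reversal \<Theta>"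
  obtains U where "unitary_matrix U" "\<Theta> = (\<lambda>v. U *v vconj v)" "reversal U ** reversal U = mat 1"
proof -
  obtain U where U: "unitary_matrix U" "\<Theta> = (\<lambda>v. U *v vconj v)"
    using antiunitary_imp_matrix assms unfolding motion_reversal_def by blast
  obtain \<phi> where "\<Theta> (\<Theta> v) = cis \<phi> *s v" for v
    using assms unfolding motion_reversal_def by blast
  then have "(U ** mconj U) *v v = cis \<phi> *s v" for v
    by (simp add: U(2) vconj_mult matrix_vector_mul_assoc)
  then have "U ** mconj U = cscale (cis \<phi>) (mat 1)"
    using matrix_vector_mult_axis[of "U ** mconj U"] by (simp add: vec_eq_iff mat_nth axis_def)
  with U show ?thesis using that reversal_involution[OF U(1), of "cis \<phi>"] by simp
qed

lemma unitary_conjugation_symmetry: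
  fixes W :: "complex^'m^'m"
  assumes "unitary_matrix W" "W ** W = mat 1"
  shows "spectral_symmetry (\<lambda>X. W ** X ** mdagger W)"
proof (rule spectral_symmetry.intro)
  have W: "mdagger W = W"
    using assms by (metis matrix_mul_assoc matrix_mul_lid matrix_mul_rid unitary_matrixD(1))
  show "linear (\<lambda>X. W ** X ** mdagger W)"
    by (rule linearI) (simp_all add: matrix_add_ldistrib matrix_mult_add_left matrix_mult_scaleR)
  fix X Y :: "complex^'m^'m"
  show "W ** (W ** X ** mdagger W) ** mdagger W = X"
    unfolding W by (metis assms(2) matrix_mul_assoc matrix_mul_lid matrix_mul_rid)
  show "trace (W ** X ** mdagger W ** Y) = trace (X ** (W ** Y ** mdagger W))"
    unfolding W by (metis matrix_mul_assoc trace_mul_sym)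
next
  fix U :: "complex^'m^'m"
  assume "unitary_matrix U"
  then have "unitary_matrix (W ** U)" by (intro unitary_matrix_mult assms)
  then show "\<exists>V. unitary_matrix V \<and> (\<forall>d. W ** (U ** real_diag d ** mdagger U) ** mdagger W
      = V ** real_diag d ** mdagger V)"
    by (intro exI[of _ "W ** U"]) (simp add: mdagger_mult matrix_mul_assoc)
qed

subsection \<open>Qubit channels\<close>

text \<open>Transposition followed by conjugation with a signed permutation matrix, when
  \<open>f\<close> is an involution and \<open>s\<close> takes the values 1 and -1.\<close>

definition flip :: "('m \<Rightarrow> 'm) \<Rightarrow> ('m \<Rightarrow> real) \<Rightarrow> complex^'m^'m \<Rightarrow> complex^'m^'m" where
  "flip f s X = (\<chi> x y. of_real (s x * s y) * X $ f y $ f x)"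

lemma flip_nth [simp]: "flip f s X $ x $ y = of_real (s x * s y) * X $ f y $ f x"
  by (simp add: flip_def)

text \<open>Transposing a matrix diagonalized with real eigenvalues conjugates the eigenvectors and
  keeps the eigenvalues; the signed permutation then only rotates the eigenbasis.\<close>

lemma flip_symmetry:
  fixes f :: "'m::finite \<Rightarrow> 'm"
  assumes f: "\<And>x. f (f x) = x" and s: "\<And>x. s (f x) = s x" "\<And>x. s x * s x = 1"
  shows "spectral_symmetry (flip f s)"
proof (rule spectral_symmetry.intro)
  have reindex: "(\<Sum>x\<in>UNIV. g (f x)) = (\<Sum>x\<in>UNIV. g x)" for g :: "'m \<Rightarrow> complex"
    by (rule sum.reindex_bij_witness[of _ f f]) (simp_all add: f)
  show "linear (flip f s)"
    by (rule linearI) (simp_all add: vec_eq_iff distrib_left)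
  fix X Y :: "complex^'m^'m"
  show "flip f s (flip f s X) = X"
  proof -
    have "s x * s y * (s y * s x) = 1" for x y
      using s(2)[of x] s(2)[of y] by (metis mult.assoc mult.left_neutral)
    then have "complex_of_real (s x * s y) * complex_of_real (s y * s x) = 1" for x y
      by (metis of_real_1 of_real_mult)
    then show ?thesis by (simp only: vec_eq_iff flip_nth f s(1) flip: mult.assoc) simp
  qed
  show "trace (flip f s X ** Y) = trace (X ** flip f s Y)"
  proof -
    have "trace (flip f s X ** Y) = (\<Sum>x\<in>UNIV. \<Sum>y\<in>UNIV. of_real (s x * s y) * X $ f y $ f x * Y $ y $ x)"
      by (simp add: trace_def matrix_mult_nth)
    also have "\<dots> = (\<Sum>x\<in>UNIV. \<Sum>y\<in>UNIV. of_real (s x * s (f y)) * X $ f (f y) $ f x * Y $ f y $ x)"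
      by (intro sum.cong refl reindex[symmetric])
    also have "\<dots> = (\<Sum>x\<in>UNIV. \<Sum>y\<in>UNIV. of_real (s (f x) * s (f y)) * X $ f (f y) $ f (f x) * Y $ f y $ f x)"
      by (rule reindex[symmetric])
    also have "\<dots> = (\<Sum>y\<in>UNIV. \<Sum>x\<in>UNIV. X $ y $ x * (of_real (s x * s y) * Y $ f y $ f x))"
      by (subst sum.swap) (simp add: f s(1) mult_ac)
    also have "\<dots> = trace (X ** flip f s Y)"
      by (simp add: trace_def matrix_mult_nth)
    finally show ?thesis .
  qed
next
  fix U :: "complex^'m^'m"
  assume U: "unitary_matrix U"
  define V :: "complex^'m^'m" where "V = (\<chi> x k. of_real (s x) * cnj (U $ f x $ k))"
  have reindex: "(\<Sum>x\<in>UNIV. g (f x)) = (\<Sum>x\<in>UNIV. g x)" for g :: "'m \<Rightarrow> complex"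
    by (rule sum.reindex_bij_witness[of _ f f]) (simp_all add: f)
  have ss: "complex_of_real (s x) * (complex_of_real (s x) * z) = z" for x z
    using s(2)[of x] by (metis mult.assoc mult.left_neutral of_real_1 of_real_mult)
  have "(mdagger V ** V) $ k $ l = mat 1 $ k $ l" for k l
  proof -
    have "(mdagger V ** V) $ k $ l = (\<Sum>x\<in>UNIV. U $ f x $ k * cnj (U $ f x $ l))"
      by (simp add: matrix_mult_nth V_def mult_ac ss)
    also have "\<dots> = (\<Sum>x\<in>UNIV. U $ x $ k * cnj (U $ x $ l))"
      by (rule reindex)
    also have "\<dots> = (mdagger U ** U) $ l $ k"
      by (simp add: matrix_mult_nth mult.commute)
    finally show ?thesis by (auto simp: unitary_matrixD[OF U] mat_nth)
  qed
  then have "mdagger V ** V = mat 1" by (simp add: vec_eq_iff)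
  then have "unitary_matrix V" by (simp add: unitary_matrix_def matrix_left_right_inverse)
  moreover have "flip f s (U ** real_diag d ** mdagger U) = V ** real_diag d ** mdagger V" for d
    by (simp add: vec_eq_iff matrix_mult_nth[of "_ ** real_diag d"] matrix_mult_real_diag_nth V_def
        sum_distrib_left mult_ac)
  ultimately show "\<exists>V. unitary_matrix V \<and>
      (\<forall>d. flip f s (U ** real_diag d ** mdagger U) = V ** real_diag d ** mdagger V)" by blast
qed

text \<open>On a pair of qubits, \<open>flip\<close> with these parameters is the spin flip
  \<open>X \<mapsto> (Y \<otimes> Y) X\<^sup>T (Y \<otimes> Y)\<close>. It fixes \<open>1\<close> and the products of two Pauli matrices, and negates the
  remaining Pauli strings; hence it fixes exactly the operators whose marginals are
  multiples of the identity.\<close>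

lemma qubit_spin_flip:
  assumes "CARD('n) = 2"
  obtains f :: "'n::finite \<times> 'n \<Rightarrow> 'n \<times> 'n" and s where "spectral_symmetry (flip f s)"
    "\<And>J. J \<in> unital_choi \<Longrightarrow> flip f s J = J"
    "\<And>J. choi_tp J \<Longrightarrow> (1 / 2) *\<^sub>R (J + flip f s J) \<in> unital_choi"
proof -
  obtain p q :: 'n where pq: "p \<noteq> q" "UNIV = {p, q}"
    using assms unfolding card_2_iff by metis
  \<comment> \<open>\<open>g\<close> exchanges the basis vectors and \<open>t\<close> carries the
    sign of the Pauli matrix Y. The resulting signs \<open>s\<close> are those of Y \<otimes> Y up
    to a global sign, which cancels in the conjugation.\<close>
  define g where "g i = (if i = p then q else p)" for i
  define t where "t i = (if i = p then 1 else - 1 :: real)" for i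
  define f where "f x = (g (fst x), g (snd x))" for x
  define s where "s x = t (fst x) * t (snd x)" for x
  have two: "i = p \<or> i = q" for i
    using pq(2) by blast
  have all: "(\<forall>i. P i) \<longleftrightarrow> P p \<and> P q" for P
    using two by metis
  have sum: "sum h UNIV = h p + h q" for h :: "'n \<Rightarrow> complex"
    unfolding pq(2) using pq(1) by simp
  have gt [simp]: "g p = q" "g q = p" "t p = 1" "t q = - 1"
    using pq(1) by (auto simp: g_def t_def)
  have g: "g (g i) = i" and t: "t (g i) = - t i" "t i * t i = 1" for i
    using all[of "\<lambda>i. g (g i) = i \<and> t (g i) = - t i \<and> t i * t i = 1"] by auto
  have fs: "f (i, j) = (g i, g j)" "s (i, j) = t i * t j" for i j
    by (simp_all add: f_def s_def)
  have "s x * s x = 1" for x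
    by (simp add: s_def t_def)
  then have sym: "spectral_symmetry (flip f s)"
    by (intro flip_symmetry) (simp_all add: f_def s_def g t)
  have pq': "q \<noteq> p" using pq(1) by blast
  have neg: "y = - x" if "x + y = 0" for x y :: complex
    using that by (simp add: eq_neg_iff_add_eq_0 add.commute)
  have eq: "y = z" if "x + y = c" "z + x = c" for x y z c :: complex
    using that by (metis add.commute add_left_cancel)
  have fixed: "flip f s J = J" if "J \<in> unital_choi" for J
  proof -
    have "choi_tp J" "choi_unital J" using that by (auto simp: unital_choi_def)
    then have m: "J $ (p, p) $ (p, p) + J $ (q, p) $ (q, p) = 1 / 2"
      "J $ (p, q) $ (p, q) + J $ (q, q) $ (q, q) = 1 / 2"
      "J $ (p, p) $ (p, q) + J $ (q, p) $ (q, q) = 0"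
      "J $ (p, q) $ (p, p) + J $ (q, q) $ (q, p) = 0"
      "J $ (p, p) $ (p, p) + J $ (p, q) $ (p, q) = 1 / 2"
      "J $ (q, p) $ (q, p) + J $ (q, q) $ (q, q) = 1 / 2"
      "J $ (p, p) $ (q, p) + J $ (p, q) $ (q, q) = 0"
      "J $ (q, p) $ (p, p) + J $ (q, q) $ (p, q) = 0"
      unfolding choi_tp_def choi_unital_def all sum using pq(1) pq' assms by simp_all
    \<comment> \<open>Two marginal equations sharing one entry force their other entries to agree,
      which matches the diagonal with its flip; the vanishing marginals match the off-diagonal
      entries, up to the sign that \<open>s\<close> supplies.\<close>
    note e = eq[OF m(2) m(5)] eq[OF m(5) m(1)[unfolded add.commute[of "J $ (p, p) $ (p, p)"]]]
      neg[OF m(3)] neg[OF m(4)] neg[OF m(7)] neg[OF m(8)]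
    have "\<forall>a i b j. (flip f s J) $ (a, i) $ (b, j) = J $ (a, i) $ (b, j)"
      unfolding all flip_nth fs gt by (simp add: e)
    then show ?thesis by (simp add: vec_eq_iff)
  qed
  \<comment> \<open>The flip sends each marginal M to (tr M) 1 - M, so averaging removes the
    traceless part of both marginals. Trace preservation supplies the total trace.\<close>
  have proj: "(1 / 2) *\<^sub>R (J + flip f s J) \<in> unital_choi" if "choi_tp J" for J
  proof -
    have m: "J $ (p, p) $ (p, p) + J $ (q, p) $ (q, p) = 1 / 2"
      "J $ (p, q) $ (p, q) + J $ (q, q) $ (q, q) = 1 / 2"
      "J $ (p, p) $ (p, q) + J $ (q, p) $ (q, q) = 0"
      "J $ (p, q) $ (p, p) + J $ (q, q) $ (q, p) = 0"
      using that[unfolded choi_tp_def all sum] pq(1) pq' assms by simp_all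
    then have e: "J $ (q, p) $ (q, p) = 1 / 2 - J $ (p, p) $ (p, p)"
      "J $ (q, q) $ (q, q) = 1 / 2 - J $ (p, q) $ (p, q)"
      "J $ (q, p) $ (q, q) = - J $ (p, p) $ (p, q)" "J $ (q, q) $ (q, p) = - J $ (p, q) $ (p, p)"
      by (simp_all add: eq_diff_eq add.commute[of _ "J $ (p, p) $ (p, p)"] add.commute[of _ "J $ (p, q) $ (p, q)"] neg)
    define H where "H = (1 / 2) *\<^sub>R (J + flip f s J)"
    have H: "H $ x $ y = (J $ x $ y + of_real (s x * s y) * J $ f y $ f x) / 2" for x y
      by (simp add: H_def scaleR_conv_of_real[where 'a = complex])
    have "choi_tp H"
      unfolding choi_tp_def all sum H fs gt assms using pq(1) pq' by (simp add: e field_simps)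
    moreover have "choi_unital H"
      unfolding choi_unital_def all sum H fs gt assms using pq(1) pq' by (simp add: e field_simps)
    ultimately show ?thesis by (simp add: unital_choi_def H_def)
  qed
  show ?thesis by (rule that[OF sym fixed proj])
qed

subsection \<open>The decomposition\<close>

lemma \<Delta>m_eq:
  assumes "\<E>' \<in> F" "\<And>\<G>. \<G> \<in> F \<Longrightarrow> rel_entropy (choi \<E>') (choi \<E>) \<le> rel_entropy (choi \<G>) (choi \<E>)"
  shows "\<Delta>m F \<E> = rel_entropy (choi \<E>') (choi \<E>)"
  unfolding \<Delta>m_def by (rule Least_equality) (use assms in auto)

lemma \<Delta>e_eq:
  assumes "\<E>' \<in> F" "\<And>\<G>. \<G> \<in> F \<Longrightarrow> rel_entropy (choi \<E>) (choi \<E>') \<le> rel_entropy (choi \<E>) (choi \<G>)"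
  shows "\<Delta>e F \<E> = rel_entropy (choi \<E>) (choi \<E>')"
  unfolding \<Delta>e_def by (rule Least_equality) (use assms in auto)

lemma is_argmin_m_iff:
  "is_argmin_m F \<E> \<E>' \<longleftrightarrow> \<E>' \<in> F \<and>
    (\<forall>\<G>\<in>F. rel_entropy (choi \<E>') (choi \<E>) \<le> rel_entropy (choi \<G>) (choi \<E>))"
  by (auto simp: is_argmin_m_def is_arg_min_linorder)

lemma is_argmin_e_iff:
  "is_argmin_e F \<E> \<E>' \<longleftrightarrow> \<E>' \<in> F \<and>
    (\<forall>\<G>\<in>F. rel_entropy (choi \<E>) (choi \<E>') \<le> rel_entropy (choi \<E>) (choi \<G>))"
  by (auto simp: is_argmin_e_def is_arg_min_linorder)

lemma affine_fixed_points:
  assumes "affine L" "linear T"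
  shows "affine {X \<in> L. T X = X}"
  using assms by (auto simp: affine_def linear_add linear_cmul)

lemma unital_projection_m:
  fixes \<rho> :: "complex^('n::finite \<times> 'n)^('n \<times> 'n)"
  assumes \<rho>: "posdef \<rho>"
  obtains \<sigma> where "\<sigma> \<in> unital_choi" "posdef \<sigma>"
    "\<And>J. J \<in> unital_choi \<Longrightarrow> psd J \<Longrightarrow> divergence J \<rho> = divergence J \<sigma> + divergence \<sigma> \<rho>"
proof -
  let ?P = "(1 / CARD('n \<times> 'n)) *\<^sub>R mat 1 :: complex^('n \<times> 'n)^('n \<times> 'n)"
  let ?K = "{J \<in> unital_choi :: (complex^('n \<times> 'n)^('n \<times> 'n)) set. psd J}"
  have tr: "trace J = 1" if "J \<in> unital_choi" for J :: "complex^('n \<times> 'n)^('n \<times> 'n)"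
    using that by (simp add: unital_choi_def trace_choi_tp)
  have P: "?P \<in> unital_choi" by (rule maximally_mixed_unital_choi)
  have "psd ?P" by (intro psd_scaleR posdef_imp_psd posdef_mat_1) simp
  with P have ne: "?K \<noteq> {}" by blast
  have K: "compact ?K" by (rule compact_states[OF affine_unital_choi tr])
  have state: "psd J \<and> trace J = 1" if "J \<in> ?K" for J using that tr by blast
  obtain \<sigma> where \<sigma>: "\<sigma> \<in> ?K" and min: "\<And>J. J \<in> ?K \<Longrightarrow> divergence \<sigma> \<rho> \<le> divergence J \<rho>"
    using divergence_minimizer_exists[OF K ne state \<rho>] by blast
  have "posdef \<sigma>"
  proof (rule divergence_minimizer_posdef[OF \<rho>, where K = ?K])
    show "(1 - t) *\<^sub>R \<sigma> + t *\<^sub>R ?P \<in> ?K" if "0 < t" "t < 1" for t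
    proof -
      have "(1 - t) *\<^sub>R \<sigma> + t *\<^sub>R ?P \<in> unital_choi"
        using \<sigma> P by (intro mem_affine[OF affine_unital_choi]) auto
      moreover have "psd ((1 - t) *\<^sub>R \<sigma> + t *\<^sub>R ?P)"
        using \<sigma> that by (intro psd_add psd_scaleR posdef_imp_psd[OF posdef_mat_1]) auto
      ultimately show ?thesis by blast
    qed
  qed (use \<sigma> tr min in auto)
  moreover have "divergence J \<rho> = divergence J \<sigma> + divergence \<sigma> \<rho>" if "J \<in> unital_choi" "psd J" for J
    by (rule divergence_pythagoras[OF affine_unital_choi tr \<rho>])
      (use \<sigma> \<open>posdef \<sigma>\<close> min that psd_imp_hermitian in auto)
  ultimately show ?thesis using \<sigma> that by blast
qed

theorem theorem5:
  fixes \<Theta> :: "complex^'n \<Rightarrow> complex^'n"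
    and \<E> :: "complex^'n^'n \<Rightarrow> complex^'n^'n"
  assumes "motion_reversal \<Theta>"
    and "channel \<E>"
    and "posdef (choi \<E>)"
  shows "(\<exists>!\<E>'. is_argmin_m Unital \<E> \<E>') \<and>
         \<Delta>m (TRS \<Theta>) \<E> = \<Delta>m Unital \<E> + \<Delta>m (TRS \<Theta>) (argmin_m Unital \<E>) \<and>
         (CARD('n) = 2 \<longrightarrow>
           (\<exists>!\<E>'. is_argmin_e Unital \<E> \<E>') \<and>
           \<Delta>e (TRS \<Theta>) \<E> = \<Delta>e Unital \<E> + \<Delta>e (TRS \<Theta>) (argmin_e Unital \<E>))"
proof -
  obtain U where U: "unitary_matrix U" "\<Theta> = (\<lambda>v. U *v vconj v)"
    and W2: "reversal U ** reversal U = mat 1"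
    using motion_reversal_imp_matrix[OF assms(1)] by blast
  define W where "W = reversal U"
  define \<rho> where "\<rho> = choi \<E>"
  have \<rho>: "posdef \<rho>" using assms(3) by (simp add: \<rho>_def)
  have W: "unitary_matrix W" by (simp add: W_def unitary_reversal[OF U(1)])
  interpret R: spectral_symmetry "\<lambda>X. W ** X ** mdagger W"
    by (rule unitary_conjugation_symmetry[OF W]) (simp add: W_def W2)
  let ?TRS = "{J \<in> unital_choi. W ** J ** mdagger W = J}"
  note Unital = Unital_iff_choi
  note TRS = TRS_iff_choi[OF U(2,1), folded W_def]
  have tr: "trace J = 1" if "J \<in> unital_choi" for J :: "complex^('n \<times> 'n)^('n \<times> 'n)"
    using that by (simp add: unital_choi_def trace_choi_tp)
  have Unital_unchoi: "unchoi J \<in> Unital" if "J \<in> unital_choi" "psd J" for J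
    using that by (simp add: Unital choi_unchoi linear_unchoi)
  have TRS_unchoi: "unchoi J \<in> TRS \<Theta>" if "J \<in> ?TRS" "psd J" for J
    using that by (simp add: TRS choi_unchoi linear_unchoi)

  obtain \<sigma> where \<sigma>: "\<sigma> \<in> unital_choi" "posdef \<sigma>"
    and pyth: "\<And>J. J \<in> unital_choi \<Longrightarrow> psd J \<Longrightarrow> divergence J \<rho> = divergence J \<sigma> + divergence \<sigma> \<rho>"
    using unital_projection_m[OF \<rho>] by blast
  have div_nonneg: "0 \<le> divergence J \<sigma>" if "J \<in> unital_choi" "psd J" for J
    using klein_inequality[OF that(2) \<sigma>(2)] tr[OF that(1)] tr[OF \<sigma>(1)] by simp
  have div_min: "divergence \<sigma> \<rho> \<le> divergence J \<rho>" if "J \<in> unital_choi" "psd J" for J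
    using pyth[OF that] div_nonneg[OF that] by simp
  \<comment> \<open>By \<open>pyth\<close> the excess of a unital channel over the minimum is its
    divergence from \<sigma>, which vanishes only at \<sigma>.\<close>
  have argmin_m: "is_argmin_m Unital \<E> \<G> \<longleftrightarrow> \<G> = unchoi \<sigma>" for \<G>
  proof
    assume "is_argmin_m Unital \<E> \<G>"
    then have G: "\<G> \<in> Unital" "divergence (choi \<G>) \<rho> \<le> divergence \<sigma> \<rho>"
      using Unital_unchoi[OF \<sigma>(1) posdef_imp_psd[OF \<sigma>(2)]] \<rho>
      by (auto simp: is_argmin_m_iff rel_entropy_posdef_right choi_unchoi simp flip: \<rho>_def)
    then have "divergence (choi \<G>) \<sigma> = 0"
      using pyth[of "choi \<G>"] div_nonneg[of "choi \<G>"] by (auto simp: Unital)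
    then have C: "choi \<G> = \<sigma>"
      using G(1) klein_equality[of "choi \<G>" \<sigma>] \<sigma> tr by (auto simp: Unital)
    show "\<G> = unchoi \<sigma>" using G(1) unchoi_choi[of \<G>] C by (simp add: Unital)
  next
    show "is_argmin_m Unital \<E> \<G>" if "\<G> = unchoi \<sigma>"
      using Unital_unchoi[OF \<sigma>(1) posdef_imp_psd[OF \<sigma>(2)]] \<rho> div_min that
      by (auto simp: is_argmin_m_iff rel_entropy_posdef_right choi_unchoi Unital simp flip: \<rho>_def)
  qed
  then have argmin_m_eq: "argmin_m Unital \<E> = unchoi \<sigma>"
    by (simp add: argmin_m_def)
  have "is_argmin_m Unital \<E> (unchoi \<sigma>)" by (simp add: argmin_m)
  then have "\<Delta>m Unital \<E> = rel_entropy (choi (unchoi \<sigma>)) (choi \<E>)"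
    by (intro \<Delta>m_eq) (auto simp: is_argmin_m_iff)
  then have \<Delta>m_Unital: "\<Delta>m Unital \<E> = ereal (divergence \<sigma> \<rho>)"
    by (simp add: choi_unchoi rel_entropy_posdef_right \<rho> flip: \<rho>_def)
  let ?P = "(1 / CARD('n \<times> 'n)) *\<^sub>R mat 1 :: complex^('n \<times> 'n)^('n \<times> 'n)"
  have "?P \<in> ?TRS"
    using maximally_mixed_unital_choi by (simp add: matrix_mult_scaleR unitary_matrixD[OF W])
  moreover have "psd ?P" by (intro psd_scaleR posdef_imp_psd posdef_mat_1) simp
  ultimately have ne: "{J \<in> ?TRS. psd J} \<noteq> {}" by blast
  have K: "compact {J \<in> ?TRS. psd J}"
    by (rule compact_states[OF affine_fixed_points[OF affine_unital_choi R.linear]]) (simp add: tr)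
  have state: "psd J \<and> trace J = 1" if "J \<in> {J \<in> ?TRS. psd J}" for J using that tr by blast
  obtain \<tau> where \<tau>: "\<tau> \<in> {J \<in> ?TRS. psd J}"
    and \<tau>_min: "\<And>J. J \<in> {J \<in> ?TRS. psd J} \<Longrightarrow> divergence \<tau> \<sigma> \<le> divergence J \<sigma>"
    using divergence_minimizer_exists[OF K ne state \<sigma>(2)] by blast
  have T: "unchoi \<tau> \<in> TRS \<Theta>" using \<tau> TRS_unchoi by blast
  have "\<Delta>m (TRS \<Theta>) (unchoi \<sigma>) = rel_entropy (choi (unchoi \<tau>)) (choi (unchoi \<sigma>))"
    by (rule \<Delta>m_eq[OF T]) (use \<tau>_min \<sigma>(2) in \<open>auto simp: choi_unchoi rel_entropy_posdef_right TRS\<close>)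
  \<comment> \<open>On T-symmetric Choi matrices the divergences from \<rho> and from \<sigma>
    differ by a constant, so the same \<tau> is optimal for both.\<close>
  moreover have "\<Delta>m (TRS \<Theta>) \<E> = rel_entropy (choi (unchoi \<tau>)) (choi \<E>)"
  proof (rule \<Delta>m_eq[OF T])
    fix \<G> assume "\<G> \<in> TRS \<Theta>"
    then have "choi \<G> \<in> {J \<in> ?TRS. psd J}" by (simp add: TRS)
    then show "rel_entropy (choi (unchoi \<tau>)) (choi \<E>) \<le> rel_entropy (choi \<G>) (choi \<E>)"
      using \<tau>_min[of "choi \<G>"] pyth[of \<tau>] pyth[of "choi \<G>"] \<tau> \<rho>
      by (simp add: choi_unchoi rel_entropy_posdef_right flip: \<rho>_def)
  qed
  ultimately have m_part: "\<Delta>m (TRS \<Theta>) \<E> = \<Delta>m Unital \<E> + \<Delta>m (TRS \<Theta>) (argmin_m Unital \<E>)"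
    using \<tau> pyth[of \<tau>] \<rho> \<sigma>(2)
    by (simp add: choi_unchoi rel_entropy_posdef_right \<Delta>m_Unital argmin_m_eq flip: \<rho>_def)

  have e_part: "(\<exists>!\<E>'. is_argmin_e Unital \<E> \<E>') \<and>
      \<Delta>e (TRS \<Theta>) \<E> = \<Delta>e Unital \<E> + \<Delta>e (TRS \<Theta>) (argmin_e Unital \<E>)"
    if d: "CARD('n) = 2"
  proof -
    obtain f :: "'n \<times> 'n \<Rightarrow> 'n \<times> 'n" and s where "spectral_symmetry (flip f s)"
      and fixed: "\<And>J. J \<in> unital_choi \<Longrightarrow> flip f s J = J"
      and proj: "\<And>J. choi_tp J \<Longrightarrow> (1 / 2) *\<^sub>R (J + flip f s J) \<in> unital_choi"
      using qubit_spin_flip[OF d] by blast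
    then interpret F: spectral_symmetry "flip f s" by simp
    define \<sigma> where "\<sigma> = F.symmetrization \<rho>"
    have \<sigma>: "\<sigma> \<in> unital_choi" "posdef \<sigma>"
      using proj[of \<rho>] assms(2) F.posdef_symmetrization[OF \<rho>]
      by (simp_all add: \<sigma>_def F.symmetrization_def channel_iff_choi \<rho>_def)
    have pyth: "rel_entropy \<rho> J = rel_entropy \<rho> \<sigma> + rel_entropy \<sigma> J" if "J \<in> unital_choi" "psd J" for J
      unfolding \<sigma>_def by (rule F.rel_entropy_symmetrization[OF \<rho> that(2) fixed[OF that(1)]])
    define \<tau> where "\<tau> = R.symmetrization \<sigma>"
    \<comment> \<open>Averaging over motion reversal stays inside the unital set, so the two
      symmetrizations can be done one after the other.\<close>
    have "W ** \<sigma> ** mdagger W \<in> unital_choi"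
      using reversal_unital_choi[OF U(1), of \<sigma>] \<sigma>(1) by (simp add: unital_choi_def W_def)
    then have "\<tau> \<in> unital_choi"
      using mem_affine[OF affine_unital_choi \<sigma>(1), of _ "1 / 2" "1 / 2"]
      by (simp add: \<tau>_def R.symmetrization_def scaleR_add_right)
    then have \<tau>: "\<tau> \<in> ?TRS" "posdef \<tau>"
      using R.T_symmetrization R.posdef_symmetrization[OF \<sigma>(2)] by (simp_all add: \<tau>_def)
    have pyth': "rel_entropy \<sigma> J = rel_entropy \<sigma> \<tau> + rel_entropy \<tau> J" if "J \<in> ?TRS" "psd J" for J
      unfolding \<tau>_def using that by (intro R.rel_entropy_symmetrization[OF \<sigma>(2)]) auto
    have \<sigma>_nonneg: "0 \<le> rel_entropy \<sigma> J" if "J \<in> unital_choi" "psd J" for J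
      using rel_entropy_nonneg[OF \<sigma>(2) that(2)] tr that(1) \<sigma>(1) by simp
    have \<tau>_nonneg: "0 \<le> rel_entropy \<tau> J" if "J \<in> unital_choi" "psd J" for J
      using rel_entropy_nonneg[OF \<tau>(2) that(2)] tr that(1) \<tau>(1) by simp
    have le: "rel_entropy \<rho> \<sigma> \<le> rel_entropy \<rho> J" if "J \<in> unital_choi" "psd J" for J
      using pyth[OF that] \<sigma>_nonneg[OF that] by (simp add: ereal_le_add_self)
    have le': "rel_entropy \<sigma> \<tau> \<le> rel_entropy \<sigma> J" if "J \<in> ?TRS" "psd J" for J
      using pyth'[OF that] \<tau>_nonneg[of J] that by (simp add: ereal_le_add_self)
    have S: "unchoi \<sigma> \<in> Unital" using \<sigma> by (intro Unital_unchoi posdef_imp_psd)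
    have T: "unchoi \<tau> \<in> TRS \<Theta>" using \<tau> by (intro TRS_unchoi posdef_imp_psd)
    have argmin_e: "is_argmin_e Unital \<E> \<G> \<longleftrightarrow> \<G> = unchoi \<sigma>" for \<G>
    proof
      assume "is_argmin_e Unital \<E> \<G>"
      then have G: "\<G> \<in> Unital" "rel_entropy \<rho> (choi \<G>) \<le> rel_entropy \<rho> \<sigma>"
        using S by (auto simp: is_argmin_e_iff choi_unchoi simp flip: \<rho>_def)
      then have C: "choi \<G> \<in> unital_choi" "psd (choi \<G>)" by (auto simp: Unital)
      \<comment> \<open>\<sigma> is positive definite, so \<open>rel_entropy \<rho> \<sigma>\<close>
        is finite and can be cancelled in the extended reals.\<close>
      have "rel_entropy \<sigma> (choi \<G>) = 0"
        using pyth[OF C] G(2) \<sigma>_nonneg[OF C] \<sigma>(2)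
        by (cases "rel_entropy \<sigma> (choi \<G>)") (auto simp: rel_entropy_posdef_right)
      then have eq: "choi \<G> = \<sigma>"
        using rel_entropy_eq_0[OF \<sigma>(2) C(2)] tr C(1) \<sigma>(1) by simp
      show "\<G> = unchoi \<sigma>" using G(1) unchoi_choi[of \<G>] eq by (simp add: Unital)
    next
      show "is_argmin_e Unital \<E> \<G>" if "\<G> = unchoi \<sigma>"
        using S le that by (auto simp: is_argmin_e_iff choi_unchoi Unital simp flip: \<rho>_def)
    qed
    then have argmin_e_eq: "argmin_e Unital \<E> = unchoi \<sigma>" by (simp add: argmin_e_def)
    have "\<Delta>e Unital \<E> = rel_entropy (choi \<E>) (choi (unchoi \<sigma>))"
      by (rule \<Delta>e_eq[OF S]) (use le in \<open>auto simp: choi_unchoi Unital simp flip: \<rho>_def\<close>)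
    moreover have "\<Delta>e (TRS \<Theta>) (unchoi \<sigma>) = rel_entropy (choi (unchoi \<sigma>)) (choi (unchoi \<tau>))"
      by (rule \<Delta>e_eq[OF T]) (use le' in \<open>auto simp: choi_unchoi TRS\<close>)
    \<comment> \<open>Adding \<open>rel_entropy \<rho> \<sigma>\<close> to both sides of
      \<open>le'\<close> transfers the optimality of \<tau> from \<sigma> to \<rho>.\<close>
    moreover have "\<Delta>e (TRS \<Theta>) \<E> = rel_entropy (choi \<E>) (choi (unchoi \<tau>))"
    proof (rule \<Delta>e_eq[OF T])
      fix \<G> assume "\<G> \<in> TRS \<Theta>"
      then have "choi \<G> \<in> ?TRS" "psd (choi \<G>)" by (auto simp: TRS)
      then show "rel_entropy (choi \<E>) (choi (unchoi \<tau>)) \<le> rel_entropy (choi \<E>) (choi \<G>)"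
        using pyth[of "choi \<G>"] pyth[of \<tau>] le'[of "choi \<G>"] \<tau> posdef_imp_psd[OF \<tau>(2)]
        by (auto simp: choi_unchoi add_left_mono simp flip: \<rho>_def)
    qed
    moreover have "rel_entropy \<rho> \<tau> = rel_entropy \<rho> \<sigma> + rel_entropy \<sigma> \<tau>"
      using pyth[of \<tau>] \<tau> posdef_imp_psd[OF \<tau>(2)] by simp
    ultimately show ?thesis
      by (simp add: argmin_e argmin_e_eq choi_unchoi flip: \<rho>_def)
  qed
  show ?thesis using argmin_m m_part e_part by simp
qed

end
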